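(* Let $n\in\mathbb N$. The direct antisymmetric sign reverse integrator at truncation level $n$ is given by $$\sum_{|w|\le n}I_w(t)\tilde V_w+\sum_{|w|=n+1}I_{\mathrm{coshlog}^{ш}(\mathrm{id})(w)}(t)\,\tilde V_w ,$$ or equivalently $$\sum_{|w|\le n}I_w(t)\tilde V_w+\sum_{|w|=n+1}\Bigl(I_{\mathrm{coshlog}^{\star}(\mathrm{id})(w)}(t)+\tfrac12I_{(S-\hat S)(w)}(t)\Bigr)\tilde V_w .$$ Here $ш$ denotes the convolution product of the shuffle product and $\star$ that of the quasi-shuffle product.
   Context: Setting: a Lévy-driven It\^o equation on $\mathbb R^N$ (independent driving Wiener processes $W^1,\dots,W^d$, $W^0_t\equiv t$, and purely discontinuous martingales $J^i_t=\int_0^t\int v\,\overline Q^i(\mathrm dv,\mathrm ds)$, $d<i\le\ell$, with moments of all orders, where $\overline Q^i$ is the compensation of a Poisson measure with intensity $\rho^i(\mathrm dv)\mathrm ds$). The alphabet $\mathbb A$ consists of $0,\dots,\ell$ (associated with $W^0,\dots,W^d,J^{d+1},\dots,J^\ell$) together with the letters $i^{(p)}$, $p\ge2$, associated with the compensated power brackets $J^{i^{(p)}}_t=\int_0^t\int v^p\,\overline Q^i(\mathrm dv,\mathrm ds)$ not in the linear span of $\{t,J^i,\dots,J^{i^{(p-1)}}\}$. $\mathbb A^*$ is the set of words, $|w|$ the word length, $\mathbb R\langle\mathbb A\rangle$ the vector space with basis $\mathbb A^*$. $I_{a_1\ldots a_m}(t)=\int_{0<\tau_1<\cdots<\tau_m<t}\mathrm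 dZ^{a_1}_{\tau_1}\cdots\mathrm dZ^{a_m}_{\tau_m}$ with $Z^a$ the process of letter $a$ ($I=1$ for the empty word), extended linearly to $\mathbb R\langle\mathbb A\rangle$. The flowmap is assumed to have a separated expansion $\sum_{w\in\mathbb A^*}I_w(t)\tilde V_w$ with $\tilde V_{a_1\ldots a_m}=\tilde V_{a_1}\circ\cdots\circ\tilde V_{a_m}$. Products: the quasi-shuffle product $*$ on $\mathbb R\langle\mathbb A\rangle$ satisfies $u*\mathbf 1=\mathbf 1*u=u$ ($\mathbf 1$ the empty word) and $ua*vb=(u*vb)a+(ua*v)b+(u*v)[a,b]$, where $[\cdot,\cdot]$ is the commutative associative product on the span of the letters corresponding to quadratic covariation of the associated processes; the shuffle product is the case $[\cdot,\cdot]=0$. The convolution of endomorphisms for a product $\bullet$ on $\mathbb R\langle\mathbb A\rangle$ is $(X,Y)\mapsto\bigl(w\mapsto\sum_{uv=w}X(u)\bullet Y(v)\bigr)$, the sum over all factorizations of $w$ by concatenation; $\star$ is the convolution for $*$ and $ш$ that for the shuffle product. In both cases the unit $\nu$ fixes $\mathbf 1$ and kills nonempty words; $\mathfrak J=\mathrm{id}-\nu$. Since $\sinh(\log(1+x))=x+\tfrac12\sum_{k\ge2}(-1)^{k-1}x^k$ and $\cosh(\log(1+x))=1+\tfrac12\sum_{k\ge2}(-1)^kx^k$, one sets $\mathrm{sinhlog}^{\bullet}(\mathrm{id})=\mathfrak J+\tfrac12\sum_{k\ge2}(-1)^{k-1}\mathfrak J^{\bullet k}$ and $\mathrm{coshlog}^{\bullet}(\mathrm{id})=\nu+\tfrac12\sum_{k\ge2}(-1)^k\mathfrak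 J^{\bullet k}$, for $\bullet=\star$ or $ш$. Endomorphisms: $S(a_1\ldots a_m)=(-1)^ma_m\ldots a_1$; the quasi-shuffle antipode is $\hat S(a_1\ldots a_m)=(-1)^m\sum[u_1][u_2]\ldots[u_k]$, the sum over all factorizations $a_m\ldots a_1=u_1\ldots u_k$ into nonempty subwords ($1\le k\le m$), where $[a]=a$ for a letter and $[b_1\ldots b_j]=[b_1,[b_2,\ldots,[b_{j-1},b_j]\ldots]]$ for a word. Both fix $\mathbf 1$. The direct antisymmetric sign reverse integrator at level $n$ is the direct map-truncate-invert scheme associated with $\tfrac12(\mathrm{id}-S)=\mathrm{sinhlog}^{ш}(\mathrm{id})$ truncated by word length: writing $\pi_{\le n}$ and $\pi_{=n+1}$ for the projections onto words of length $\le n$ and $=n+1$, it is the approximate flow $\sum_wI_{H(w)}(t)\tilde V_w$ with $H=\pi_{\le n}+\pi_{=n+1}\circ\bigl(\mathfrak J-\tfrac12(\mathrm{id}-S)\bigr)$. *)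

theory Defs
  imports "HOL-Probability.Probability" "HOL-Library.Poly_Mapping"
begin

section \<open>Words and endomorphisms\<close>

instantiation poly_mapping :: (type, real_vector) real_vector
begin

lift_definition scaleR_poly_mapping :: "real \<Rightarrow> ('a \<Rightarrow>\<^sub>0 'b) \<Rightarrow> ('a \<Rightarrow>\<^sub>0 'b)"
  is "\<lambda>r f k. r *\<^sub>R f k"
  by (rule finite_subset[rotated]) auto

instance
  by standard (transfer; simp add: fun_eq_iff scaleR_add_right scaleR_add_left)+

end

lemma lookup_scaleR: "Poly_Mapping.lookup (r *\<^sub>R x) k = r *\<^sub>R Poly_Mapping.lookup x k"
  by transfer simp

type_synonym 'a words = "'a list \<Rightarrow>\<^sub>0 real"

definition word :: "'a list \<Rightarrow> 'a words" where
  "word w = Poly_Mapping.single w 1"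

definition lin_ext :: "('k \<Rightarrow> 'v::real_vector) \<Rightarrow> ('k \<Rightarrow>\<^sub>0 real) \<Rightarrow> 'v" where
  "lin_ext g x = (\<Sum>k\<in>Poly_Mapping.keys x. Poly_Mapping.lookup x k *\<^sub>R g k)"

definition bilin_ext :: "('k \<Rightarrow> 'k \<Rightarrow> 'v::real_vector) \<Rightarrow> ('k \<Rightarrow>\<^sub>0 real) \<Rightarrow> ('k \<Rightarrow>\<^sub>0 real) \<Rightarrow> 'v" where
  "bilin_ext g x y = lin_ext (\<lambda>k. lin_ext (g k) y) x"

definition concat_prod :: "'a words \<Rightarrow> 'a words \<Rightarrow> 'a words" where
  "concat_prod = bilin_ext (\<lambda>u v. word (u @ v))"

definition letters :: "('a \<Rightarrow>\<^sub>0 real) \<Rightarrow> 'a words" where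
  "letters = lin_ext (\<lambda>a. word [a])"

text \<open>The recursion of the quasi-shuffle product peels off last letters, so it is run on the
  reversed words; the recursion in its usual form is \<open>qshuffle_word_snoc\<close> below.
  A bracket \<open>br\<close> is given by its values on pairs of letters.\<close>

fun qshuffle_rev :: "('a \<Rightarrow> 'a \<Rightarrow> ('a \<Rightarrow>\<^sub>0 real)) \<Rightarrow> 'a list \<Rightarrow> 'a list \<Rightarrow> 'a words" where
  "qshuffle_rev br [] v = word (rev v)"
| "qshuffle_rev br (a # u) [] = word (rev (a # u))"
| "qshuffle_rev br (a # u) (b # v) =
     concat_prod (qshuffle_rev br u (b # v)) (word [a])
   + concat_prod (qshuffle_rev br (a # u) v) (word [b])
   + concat_prod (qshuffle_rev br u v) (letters (br a b))"

definition qshuffle_word :: "('a \<Rightarrow> 'a \<Rightarrow> ('a \<Rightarrow>\<^sub>0 real)) \<Rightarrow> 'a list \<Rightarrow> 'a list \<Rightarrow> 'a words" where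
  "qshuffle_word br u v = qshuffle_rev br (rev u) (rev v)"

lemma qshuffle_word_Nil: "qshuffle_word br [] v = word v" "qshuffle_word br u [] = word u"
proof -
  show "qshuffle_word br [] v = word v"
    by (simp add: qshuffle_word_def)
  show "qshuffle_word br u [] = word u"
    unfolding qshuffle_word_def by (cases "rev u") (auto simp flip: rev_swap)
qed

lemma qshuffle_word_snoc:
  "qshuffle_word br (u @ [a]) (v @ [b]) =
     concat_prod (qshuffle_word br u (v @ [b])) (word [a])
   + concat_prod (qshuffle_word br (u @ [a]) v) (word [b])
   + concat_prod (qshuffle_word br u v) (letters (br a b))"
  by (simp add: qshuffle_word_def)

definition qshuffle :: "('a \<Rightarrow> 'a \<Rightarrow> ('a \<Rightarrow>\<^sub>0 real)) \<Rightarrow> 'a words \<Rightarrow> 'a words \<Rightarrow> 'a words" where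
  "qshuffle br = bilin_ext (qshuffle_word br)"

definition shuffle :: "'a words \<Rightarrow> 'a words \<Rightarrow> 'a words" where
  "shuffle = qshuffle (\<lambda>a b. 0)"

definition convol ::
  "('a words \<Rightarrow> 'a words \<Rightarrow> 'a words) \<Rightarrow> ('a words \<Rightarrow> 'a words) \<Rightarrow> ('a words \<Rightarrow> 'a words)
    \<Rightarrow> 'a words \<Rightarrow> 'a words" where
  "convol m X Y = lin_ext (\<lambda>w. \<Sum>(u, v)\<in>{(u, v). u @ v = w}. m (X (word u)) (Y (word v)))"

definition conv_unit :: "'a words \<Rightarrow> 'a words" where
  "conv_unit = lin_ext (\<lambda>w. if w = [] then word [] else 0)"

definition augm :: "'a words \<Rightarrow> 'a words" where
  "augm x = x - conv_unit x"

primrec conv_power ::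
  "('a words \<Rightarrow> 'a words \<Rightarrow> 'a words) \<Rightarrow> ('a words \<Rightarrow> 'a words) \<Rightarrow> nat \<Rightarrow> 'a words \<Rightarrow> 'a words" where
  "conv_power m X 0 = conv_unit"
| "conv_power m X (Suc k) = convol m X (conv_power m X k)"

text \<open>The series is locally finite: only the powers up to the length of a word act
  nontrivially on it, so that \<open>Sum_any\<close> is the sum over all \<open>k \<ge> 2\<close>.\<close>

definition coshlog :: "('a words \<Rightarrow> 'a words \<Rightarrow> 'a words) \<Rightarrow> 'a words \<Rightarrow> 'a words" where
  "coshlog m x = conv_unit x
     + (1/2) *\<^sub>R Sum_any (\<lambda>k::nat. if 2 \<le> k then (-1) ^ k *\<^sub>R conv_power m augm k x else 0)"

definition sign_rev :: "'a words \<Rightarrow> 'a words" where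
  "sign_rev = lin_ext (\<lambda>w. (-1) ^ length w *\<^sub>R word (rev w))"

text \<open>The value at the empty word is irrelevant: only nonempty factors are bracketed.\<close>

fun iter_bracket :: "('a \<Rightarrow> 'a \<Rightarrow> ('a \<Rightarrow>\<^sub>0 real)) \<Rightarrow> 'a list \<Rightarrow> ('a \<Rightarrow>\<^sub>0 real)" where
  "iter_bracket br [] = 0"
| "iter_bracket br [a] = Poly_Mapping.single a 1"
| "iter_bracket br (a # b # u) =
     bilin_ext br (Poly_Mapping.single a 1) (iter_bracket br (b # u))"

definition qs_antipode :: "('a \<Rightarrow> 'a \<Rightarrow> ('a \<Rightarrow>\<^sub>0 real)) \<Rightarrow> 'a words \<Rightarrow> 'a words" where
  "qs_antipode br = lin_ext (\<lambda>w. (-1) ^ length w *\<^sub>R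
     (\<Sum>us\<in>{us. concat us = rev w \<and> [] \<notin> set us}.
        foldr concat_prod (map (\<lambda>u. letters (iter_bracket br u)) us) (word [])))"

definition proj_words :: "(nat \<Rightarrow> bool) \<Rightarrow> 'a words \<Rightarrow> 'a words" where
  "proj_words P = lin_ext (\<lambda>w. if P (length w) then word w else 0)"

definition direct_mti :: "nat \<Rightarrow> ('a words \<Rightarrow> 'a words) \<Rightarrow> 'a words \<Rightarrow> 'a words" where
  "direct_mti n E x = proj_words (\<lambda>k. k \<le> n) x + proj_words (\<lambda>k. k = n + 1) (augm x - E x)"

definition antisym_sign_rev_map :: "nat \<Rightarrow> 'a words \<Rightarrow> 'a words" where
  "antisym_sign_rev_map n = direct_mti n (\<lambda>x. (1/2) *\<^sub>R (x - sign_rev x))"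

section \<open>Processes\<close>

type_synonym 'o process = "real \<Rightarrow> 'o \<Rightarrow> real"

definition tendsto_prob :: "'o measure \<Rightarrow> ('i \<Rightarrow> 'o \<Rightarrow> real) \<Rightarrow> ('o \<Rightarrow> real) \<Rightarrow> 'i filter \<Rightarrow> bool" where
  "tendsto_prob M X L F \<longleftrightarrow> L \<in> borel_measurable M \<and>
     (\<forall>\<epsilon>>0. ((\<lambda>i. measure M {\<omega> \<in> space M. \<epsilon> < \<bar>X i \<omega> - L \<omega>\<bar>}) \<longlongrightarrow> 0) F)"

definition cadlag :: "(real \<Rightarrow> 'b::topological_space) \<Rightarrow> bool" where
  "cadlag x \<longleftrightarrow> (\<forall>t\<ge>0. (x \<longlongrightarrow> x t) (at_right t)) \<and> (\<forall>t>0. \<exists>z. (x \<longlongrightarrow> z) (at_left t))"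

definition cadlag_process :: "'o measure \<Rightarrow> (real \<Rightarrow> 'o \<Rightarrow> 'b::topological_space) \<Rightarrow> bool" where
  "cadlag_process M X \<longleftrightarrow>
     (\<forall>t\<ge>0. X t \<in> borel_measurable M) \<and> (\<forall>\<omega>\<in>space M. cadlag (\<lambda>t. X t \<omega>))"

definition left_lim :: "(real \<Rightarrow> 'o \<Rightarrow> 'b::t2_space) \<Rightarrow> real \<Rightarrow> 'o \<Rightarrow> 'b" where
  "left_lim X s \<omega> = Lim (at_left s) (\<lambda>r. X r \<omega>)"

definition wiener :: "'o measure \<Rightarrow> 'o process \<Rightarrow> bool" where
  "wiener M W \<longleftrightarrow>
     (\<forall>t\<ge>0. W t \<in> borel_measurable M) \<and>
     (AE \<omega> in M. W 0 \<omega> = 0) \<and>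
     (\<forall>\<omega>\<in>space M. continuous_on {0..} (\<lambda>t. W t \<omega>)) \<and>
     (\<forall>s t. 0 \<le> s \<and> s < t \<longrightarrow>
        distributed M lborel (\<lambda>\<omega>. W t \<omega> - W s \<omega>) (normal_density 0 (sqrt (t - s)))) \<and>
     (\<forall>(\<tau> :: nat \<Rightarrow> real) k. mono \<tau> \<and> 0 \<le> \<tau> 0 \<longrightarrow>
        prob_space.indep_vars M (\<lambda>_. borel) (\<lambda>j \<omega>. W (\<tau> (Suc j)) \<omega> - W (\<tau> j) \<omega>) {..<k})"

definition poisson_random_measure :: "'o measure \<Rightarrow> ('o \<Rightarrow> 'e measure) \<Rightarrow> 'e measure \<Rightarrow> bool" where
  "poisson_random_measure M Q \<mu> \<longleftrightarrow>
     (\<forall>\<omega>\<in>space M. sets (Q \<omega>) = sets \<mu>) \<and>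
     (\<forall>B\<in>sets \<mu>. (\<lambda>\<omega>. emeasure (Q \<omega>) B) \<in> borel_measurable M) \<and>
     (\<forall>B\<in>sets \<mu>. emeasure \<mu> B < \<infinity> \<longrightarrow>
        (\<forall>k::nat. measure M {\<omega> \<in> space M. emeasure (Q \<omega>) B = of_nat k}
                 = exp (- measure \<mu> B) * measure \<mu> B ^ k / fact k)) \<and>
     (\<forall>B\<in>sets \<mu>. emeasure \<mu> B = \<infinity> \<longrightarrow> (AE \<omega> in M. emeasure (Q \<omega>) B = \<infinity>)) \<and>
     (\<forall>(B :: nat \<Rightarrow> 'e set) k. (\<forall>j<k. B j \<in> sets \<mu>) \<and> disjoint_family_on B {..<k} \<longrightarrow>
        prob_space.indep_vars M (\<lambda>_. borel) (\<lambda>j \<omega>. emeasure (Q \<omega>) (B j)) {..<k})"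

definition intensity :: "real measure \<Rightarrow> (real \<times> real) measure" where
  "intensity \<rho> = \<rho> \<Otimes>\<^sub>M restrict_space lborel {0..}"

text \<open>\<open>X\<close> is the integral of \<open>g(v)\<close> over \<open>\<real> \<times> (0, t]\<close> against the compensated measure
  \<open>Q(dv, ds) - \<rho>(dv) ds\<close>, that is, the mean-square limit as \<open>\<epsilon> \<rightarrow> 0\<close> of the integrals
  over \<open>\<bar>v\<bar> > \<epsilon>\<close>.\<close>

definition compensated_integral ::
  "'o measure \<Rightarrow> ('o \<Rightarrow> (real \<times> real) measure) \<Rightarrow> real measure \<Rightarrow> (real \<Rightarrow> real) \<Rightarrow> real
    \<Rightarrow> ('o \<Rightarrow> real) \<Rightarrow> bool" where
  "compensated_integral M Q \<rho> g t X \<longleftrightarrow>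
     ((\<lambda>\<epsilon>. \<integral>\<^sup>+\<omega>. ennreal ((X \<omega> -
          ((LINT x:{(v, s). \<epsilon> < \<bar>v\<bar> \<and> 0 < s \<and> s \<le> t}|Q \<omega>. g (fst x))
           - t * (LINT v:{v. \<epsilon> < \<bar>v\<bar>}|\<rho>. g v)))\<^sup>2) \<partial>M) \<longlongrightarrow> 0) (at_right 0)"

text \<open>A simple predictable process is a list of triples \<open>(a, b, \<xi>)\<close>, standing for the sum of
  the processes \<open>\<xi> 1\<^bsub>(a, b]\<^esub>\<close> with \<open>\<xi>\<close> bounded and measurable at time \<open>a\<close>.\<close>

type_synonym 'o elem = "(real \<times> real \<times> ('o \<Rightarrow> real)) list"

definition elem_predictable :: "(real \<Rightarrow> 'o measure) \<Rightarrow> 'o elem \<Rightarrow> bool" where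
  "elem_predictable F h \<longleftrightarrow> (\<forall>(a, b, \<xi>)\<in>set h.
     0 \<le> a \<and> a \<le> b \<and> \<xi> \<in> borel_measurable (F a) \<and> bounded (\<xi> ` space (F a)))"

definition elem_value :: "'o elem \<Rightarrow> 'o process" where
  "elem_value h s \<omega> = (\<Sum>(a, b, \<xi>)\<leftarrow>h. \<xi> \<omega> * indicator {a<..b} s)"

definition elem_integral :: "'o elem \<Rightarrow> 'o process \<Rightarrow> 'o process" where
  "elem_integral h Z t \<omega> = (\<Sum>(a, b, \<xi>)\<leftarrow>h. \<xi> \<omega> * (Z (min b t) \<omega> - Z (min a t) \<omega>))"

text \<open>\<open>X\<close> is the Ito integral process of \<open>H\<close> against \<open>Z\<close>. The integrators are a deterministic
  time, Wiener processes and compensated Poisson integrals, whose predictable brackets are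
  multiples of \<open>t\<close>; therefore the integral is the extension from simple processes by
  convergence in probability of \<open>\<integral>\<^sub>0\<^sup>t (h\<^sub>k - H)\<^sup>2 ds\<close>.\<close>

definition ito_integral ::
  "'o measure \<Rightarrow> (real \<Rightarrow> 'o measure) \<Rightarrow> 'o process \<Rightarrow> 'o process \<Rightarrow> 'o process \<Rightarrow> bool" where
  "ito_integral M F H Z X \<longleftrightarrow>
     (\<lambda>(s, \<omega>). H s \<omega>) \<in> borel_measurable (restrict_space lborel {0<..} \<Otimes>\<^sub>M M) \<and>
     (\<forall>t\<ge>0. \<exists>h :: nat \<Rightarrow> 'o elem.
        (\<forall>k. elem_predictable F (h k)) \<and>
        (\<forall>\<epsilon>>0. (\<lambda>k. measure M {\<omega> \<in> space M. ennreal \<epsilon> <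
            (\<integral>\<^sup>+s\<in>{0<..t}. ennreal ((elem_value (h k) s \<omega> - H s \<omega>)\<^sup>2) \<partial>lborel)})
            \<longlonglongrightarrow> 0) \<and>
        tendsto_prob M (\<lambda>k. elem_integral (h k) Z t) (X t) sequentially)"

definition quad_covariation :: "'o measure \<Rightarrow> 'o process \<Rightarrow> 'o process \<Rightarrow> 'o process \<Rightarrow> bool" where
  "quad_covariation M X Y C \<longleftrightarrow>
     (\<forall>t\<ge>0. \<forall>(\<tau> :: nat \<Rightarrow> nat \<Rightarrow> real) (K :: nat \<Rightarrow> nat).
        (\<forall>m. mono (\<tau> m) \<and> \<tau> m 0 = 0 \<and> \<tau> m (K m) = t) \<and>
        (\<forall>\<delta>>0. \<forall>\<^sub>F m in sequentially. \<forall>k<K m. \<tau> m (Suc k) - \<tau> m k < \<delta>) \<longrightarrow>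
        tendsto_prob M
          (\<lambda>m \<omega>. \<Sum>k<K m. (X (\<tau> m (Suc k)) \<omega> - X (\<tau> m k) \<omega>) * (Y (\<tau> m (Suc k)) \<omega> - Y (\<tau> m k) \<omega>))
          (C t) sequentially)"

section \<open>The alphabet and the driving processes\<close>

text \<open>\<open>Gen i\<close> is the letter \<open>i\<close> and \<open>Pow i p\<close> the letter \<open>i\<^bsup>(p)\<^esup>\<close>, which is used for
  \<open>p \<ge> 2\<close> only.\<close>

datatype letter = Gen nat | Pow nat nat

definition power_letter :: "nat \<Rightarrow> nat \<Rightarrow> letter" where
  "power_letter i p = (if p = 1 then Gen i else Pow i p)"

definition in_lower_span :: "'o measure \<Rightarrow> (letter \<Rightarrow> 'o process) \<Rightarrow> nat \<Rightarrow> nat \<Rightarrow> bool" where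
  "in_lower_span M Z i p \<longleftrightarrow> (\<exists>c :: nat \<Rightarrow> real. \<forall>t\<ge>0. AE \<omega> in M.
     Z (power_letter i p) t \<omega> = c 0 * t + (\<Sum>r\<in>{1..<p}. c r * Z (power_letter i r) t \<omega>))"

definition alphabet :: "'o measure \<Rightarrow> nat \<Rightarrow> nat \<Rightarrow> (letter \<Rightarrow> 'o process) \<Rightarrow> letter set" where
  "alphabet M d l Z = Gen ` {0..l} \<union>
     {Pow i p | i p. d < i \<and> i \<le> l \<and> 2 \<le> p \<and> \<not> in_lower_span M Z i p}"

definition driver_events ::
  "'o measure \<Rightarrow> nat \<Rightarrow> (nat \<Rightarrow> real measure) \<Rightarrow> (nat \<Rightarrow> 'o \<Rightarrow> (real \<times> real) measure)
    \<Rightarrow> (letter \<Rightarrow> 'o process) \<Rightarrow> nat \<Rightarrow> real set \<Rightarrow> 'o set set" where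
  "driver_events M d \<rho> Q Z i T =
     (if i \<le> d
      then {{\<omega> \<in> space M. Z (Gen i) s \<omega> \<in> C} | s C. s \<in> T \<and> C \<in> sets borel}
      else {{\<omega> \<in> space M. emeasure (Q i \<omega>) B \<in> C} | B C.
              B \<in> sets (intensity (\<rho> i)) \<and> B \<subseteq> UNIV \<times> T \<and> C \<in> sets borel})"

definition driver_filtration ::
  "'o measure \<Rightarrow> nat \<Rightarrow> nat \<Rightarrow> (nat \<Rightarrow> real measure) \<Rightarrow> (nat \<Rightarrow> 'o \<Rightarrow> (real \<times> real) measure)
    \<Rightarrow> (letter \<Rightarrow> 'o process) \<Rightarrow> real \<Rightarrow> 'o measure" where
  "driver_filtration M d l \<rho> Q Z t =
     sigma (space M) (\<Union>i\<in>{1..l}. driver_events M d \<rho> Q Z i {0..t})"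

section \<open>Expansions of the flow\<close>

definition word_integral :: "(letter list \<Rightarrow> 'o process) \<Rightarrow> letter words \<Rightarrow> 'o process" where
  "word_integral I x t \<omega> = lin_ext (\<lambda>w. I w t \<omega>) x"

definition word_op :: "(letter \<Rightarrow> ('s \<Rightarrow> real) \<Rightarrow> 's \<Rightarrow> real) \<Rightarrow> letter list \<Rightarrow> ('s \<Rightarrow> real) \<Rightarrow> 's \<Rightarrow> real"
  where "word_op Vt w = foldr (\<circ>) (map Vt w) id"

text \<open>The formal series with random coefficients \<open>\<Sum>\<^bsub>w \<in> P\<^esub> c\<^sub>w V\<^sub>w\<close>, as its family of terms;
  each term is a random operator on functions on the state space.\<close>

definition formal_series ::
  "(letter \<Rightarrow> ('s \<Rightarrow> real) \<Rightarrow> 's \<Rightarrow> real) \<Rightarrow> letter list set \<Rightarrow> (letter list \<Rightarrow> 'o \<Rightarrow> real)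
    \<Rightarrow> letter list \<Rightarrow> 'o \<Rightarrow> ('s \<Rightarrow> real) \<Rightarrow> 's \<Rightarrow> real" where
  "formal_series Vt P c w \<omega> f y = (if w \<in> P then c w \<omega> * word_op Vt w f y else 0)"

text \<open>The random operator \<open>\<Phi>\<close> on the test functions \<open>D\<close> is the sum \<open>\<Sum>\<^bsub>w \<in> P\<^esub> c\<^sub>w V\<^sub>w\<close>. As the
  alphabet may be infinite, the sum is the unconditional one, in probability, for each test
  function and initial value.\<close>

definition series_sum ::
  "'o measure \<Rightarrow> ('s \<Rightarrow> real) set \<Rightarrow> (letter \<Rightarrow> ('s \<Rightarrow> real) \<Rightarrow> 's \<Rightarrow> real) \<Rightarrow> letter list set
    \<Rightarrow> (letter list \<Rightarrow> 'o \<Rightarrow> real) \<Rightarrow> (('s \<Rightarrow> real) \<Rightarrow> 's \<Rightarrow> 'o \<Rightarrow> real) \<Rightarrow> bool" where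
  "series_sum M D Vt P c \<Phi> \<longleftrightarrow> (\<forall>f\<in>D. \<forall>y.
     tendsto_prob M (\<lambda>F \<omega>. \<Sum>w\<in>F. c w \<omega> * word_op Vt w f y) (\<Phi> f y) (finite_subsets_at_top P))"

text \<open>\<open>Z\<close> assigns to each letter its process, \<open>br\<close> is the bracket of letters, \<open>I\<close> the family of
  iterated integrals (any version), \<open>Y t y\<close> the solution started at \<open>y\<close>, and \<open>Vt\<close> gives the
  operators of the separated expansion, acting on a space \<open>D\<close> of test functions.\<close>

locale levy_flow = prob_space M
  for M :: "'o measure" +
  fixes d l :: nat
    and \<rho> :: "nat \<Rightarrow> real measure"
    and Q :: "nat \<Rightarrow> 'o \<Rightarrow> (real \<times> real) measure"
    and Z :: "letter \<Rightarrow> 'o process"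
    and br :: "letter \<Rightarrow> letter \<Rightarrow> (letter \<Rightarrow>\<^sub>0 real)"
    and I :: "letter list \<Rightarrow> 'o process"
    and V :: "nat \<Rightarrow> real ^ 'n \<Rightarrow> real ^ 'n"
    and Y :: "real \<Rightarrow> real ^ 'n \<Rightarrow> 'o \<Rightarrow> real ^ 'n"
    and D :: "(real ^ 'n \<Rightarrow> real) set"
    and Vt :: "letter \<Rightarrow> (real ^ 'n \<Rightarrow> real) \<Rightarrow> real ^ 'n \<Rightarrow> real"
  assumes d_le_l: "d \<le> l"
    and time: "\<And>t \<omega>. Z (Gen 0) t \<omega> = t"
    and wiener: "\<And>i. 1 \<le> i \<Longrightarrow> i \<le> d \<Longrightarrow> wiener M (Z (Gen i))"
    and levy_measure: "\<And>i. d < i \<Longrightarrow> i \<le> l \<Longrightarrow> sets (\<rho> i) = sets borel \<and>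
          emeasure (\<rho> i) {0} = 0 \<and> (\<integral>\<^sup>+v. ennreal (v\<^sup>2) \<partial>\<rho> i) < \<infinity>"
    and poisson: "\<And>i. d < i \<Longrightarrow> i \<le> l \<Longrightarrow> poisson_random_measure M (Q i) (intensity (\<rho> i))"
    and indep: "indep_sets (\<lambda>i. sigma_sets (space M) (driver_events M d \<rho> Q Z i {0..})) {1..l}"
    and jump: "\<And>i p. d < i \<Longrightarrow> i \<le> l \<Longrightarrow> 1 \<le> p \<Longrightarrow> cadlag_process M (Z (power_letter i p)) \<and>
          (\<forall>t\<ge>0. compensated_integral M (Q i) (\<rho> i) (\<lambda>v. v ^ p) t (Z (power_letter i p) t))"
    and moments: "\<And>i p t. d < i \<Longrightarrow> i \<le> l \<Longrightarrow> 0 \<le> t \<Longrightarrow> integrable M (\<lambda>\<omega>. \<bar>Z (Gen i) t \<omega>\<bar> ^ p)"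
    and bracket_closed: "\<And>a b. a \<in> alphabet M d l Z \<Longrightarrow> b \<in> alphabet M d l Z \<Longrightarrow>
          Poly_Mapping.keys (br a b) \<subseteq> alphabet M d l Z"
    and bracket_commute: "\<And>a b. a \<in> alphabet M d l Z \<Longrightarrow> b \<in> alphabet M d l Z \<Longrightarrow>
          br a b = br b a"
    and bracket_assoc: "\<And>a b c. a \<in> alphabet M d l Z \<Longrightarrow> b \<in> alphabet M d l Z \<Longrightarrow>
          c \<in> alphabet M d l Z \<Longrightarrow>
          bilin_ext br (br a b) (Poly_Mapping.single c 1)
            = bilin_ext br (Poly_Mapping.single a 1) (br b c)"
    and bracket_covariation: "\<And>a b. a \<in> alphabet M d l Z \<Longrightarrow> b \<in> alphabet M d l Z \<Longrightarrow>
          quad_covariation M (Z a) (Z b) (\<lambda>t \<omega>. lin_ext (\<lambda>c. Z c t \<omega>) (br a b))"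
    and integral_Nil: "\<And>t \<omega>. I [] t \<omega> = 1"
    and integral_cadlag: "\<And>w. w \<in> lists (alphabet M d l Z) \<Longrightarrow> cadlag_process M (I w)"
    and integral_snoc: "\<And>w a. w \<in> lists (alphabet M d l Z) \<Longrightarrow> a \<in> alphabet M d l Z \<Longrightarrow>
          ito_integral M (driver_filtration M d l \<rho> Q Z) (left_lim (I w)) (Z a) (I (w @ [a]))"
    and solution_cadlag: "\<And>y. cadlag_process M (\<lambda>t. Y t y)"
    and solution: "\<And>y j. \<exists>X :: nat \<Rightarrow> 'o process.
          (\<forall>i\<le>l. ito_integral M (driver_filtration M d l \<rho> Q Z)
             (\<lambda>s \<omega>. V i (left_lim (\<lambda>r. Y r y) s \<omega>) $ j) (Z (Gen i)) (X i)) \<and>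
          (\<forall>t\<ge>0. AE \<omega> in M. Y t y \<omega> $ j = y $ j + (\<Sum>i\<le>l. X i t \<omega>))"
    and test_subspace: "(\<lambda>_. 0) \<in> D"
          "\<And>f g c. f \<in> D \<Longrightarrow> g \<in> D \<Longrightarrow> (\<lambda>y. f y + c * g y) \<in> D"
    and op_closed: "\<And>a f. a \<in> alphabet M d l Z \<Longrightarrow> f \<in> D \<Longrightarrow> Vt a f \<in> D"
    and op_linear: "\<And>a f g c. a \<in> alphabet M d l Z \<Longrightarrow> f \<in> D \<Longrightarrow> g \<in> D \<Longrightarrow>
          Vt a (\<lambda>y. f y + c * g y) = (\<lambda>y. Vt a f y + c * Vt a g y)"
    and separated_expansion: "\<And>t. 0 \<le> t \<Longrightarrow>
          series_sum M D Vt (lists (alphabet M d l Z)) (\<lambda>w. I w t) (\<lambda>f y \<omega>. f (Y t y \<omega>))"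

end

theory Submission
  imports Defs
begin

text \<open>On words of length \<open>n + 1\<close> the integrator uses \<open>(id + S) / 2\<close>. The convolution inverse of the
  identity is the Neumann series of \<open>(-1)\<^sup>k J\<^sup>k\<close> over \<open>k \<ge> 0\<close>, so \<open>coshlog\<close> is half the sum of the
  identity and this inverse, and everything rests on identifying the inverse with the explicit
  antipode. For this it suffices that \<open>id \<star> S'\<close> kills nonempty words: peeling off last letters
  writes the product of a prefix with the antipode of the remaining suffix as a sum of two
  neighbouring terms, and the alternating sum over all splittings telescopes. The shuffle case is
  the zero bracket.

  For the convergence statement, a subfamily of an unconditionally summable family is again
  summable in probability, since convergence in probability is complete (pass to a fast Cauchy
  sequence and use Borel--Cantelli).\<close>

section \<open>Linear extensions\<close>

lemma lin_ext_superset: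
  assumes "finite S" "Poly_Mapping.keys x \<subseteq> S"
  shows "lin_ext g x = (\<Sum>k\<in>S. Poly_Mapping.lookup x k *\<^sub>R g k)"
  unfolding lin_ext_def using assms
  by (intro sum.mono_neutral_left) (auto simp: in_keys_iff)

lemma linear_lin_ext: "linear (lin_ext g)"
proof (rule linearI)
  fix x y :: "'a \<Rightarrow>\<^sub>0 real" and c :: real
  let ?S = "Poly_Mapping.keys x \<union> Poly_Mapping.keys y"
  have "lin_ext g (x + y) = (\<Sum>k\<in>?S. Poly_Mapping.lookup (x + y) k *\<^sub>R g k)"
    by (rule lin_ext_superset) (use Poly_Mapping.keys_add[of x y] in auto)
  also have "\<dots> = lin_ext g x + lin_ext g y"
    by (simp add: lin_ext_superset[of ?S] lookup_add scaleR_add_left sum.distrib)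
  finally show "lin_ext g (x + y) = lin_ext g x + lin_ext g y" .
  have "lin_ext g (c *\<^sub>R x) = (\<Sum>k\<in>Poly_Mapping.keys x. Poly_Mapping.lookup (c *\<^sub>R x) k *\<^sub>R g k)"
    by (rule lin_ext_superset) (auto simp: in_keys_iff lookup_scaleR)
  then show "lin_ext g (c *\<^sub>R x) = c *\<^sub>R lin_ext g x"
    by (simp add: lin_ext_def lookup_scaleR scaleR_sum_right)
qed

lemmas lin_ext_simps [simp] =
  linear_add[OF linear_lin_ext] linear_diff[OF linear_lin_ext] linear_scale[OF linear_lin_ext]
  linear_0[OF linear_lin_ext] linear_neg[OF linear_lin_ext]

lemma lin_ext_single [simp]: "lin_ext g (Poly_Mapping.single k 1) = g k"
  by (simp add: lin_ext_def)

lemma lin_ext_word [simp]: "lin_ext g (word w) = g w"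
  by (simp add: word_def)

lemma lin_ext_fun_add: "lin_ext (\<lambda>k. g k + h k) x = lin_ext g x + lin_ext h x"
  by (simp add: lin_ext_def scaleR_add_right sum.distrib)

lemma lin_ext_fun_scale: "lin_ext (\<lambda>k. c *\<^sub>R g k) x = c *\<^sub>R lin_ext g x"
  by (simp add: lin_ext_def scaleR_sum_right mult.commute)

lemma lin_ext_single_id: "lin_ext (\<lambda>k. Poly_Mapping.single k 1) x = x"
proof (rule poly_mapping_eqI)
  fix k
  have "Poly_Mapping.lookup (lin_ext (\<lambda>k. Poly_Mapping.single k 1) x) k
      = (\<Sum>j\<in>Poly_Mapping.keys x. if j = k then Poly_Mapping.lookup x j else 0)"
    unfolding lin_ext_def lookup_sum
    by (rule sum.cong) (auto simp: lookup_scaleR lookup_single when_def)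
  then show "Poly_Mapping.lookup (lin_ext (\<lambda>k. Poly_Mapping.single k 1) x) k = Poly_Mapping.lookup x k"
    by (auto simp: in_keys_iff)
qed

text \<open>Reduces multilinear identities to basis elements, one argument at a time. Testing only
  the support of \<open>x\<close> matters because the bracket axioms are available only for letters
  of the alphabet.\<close>

lemma linear_eq_on_keys:
  fixes x :: "'k \<Rightarrow>\<^sub>0 real" and f g :: "('k \<Rightarrow>\<^sub>0 real) \<Rightarrow> 'v::real_vector"
  assumes "linear f" "linear g"
    and "\<And>k. k \<in> Poly_Mapping.keys x \<Longrightarrow> f (Poly_Mapping.single k 1) = g (Poly_Mapping.single k 1)"
  shows "f x = g x"
proof -
  have "h x = (\<Sum>k\<in>Poly_Mapping.keys x. Poly_Mapping.lookup x k *\<^sub>R h (Poly_Mapping.single k 1))"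
    if "linear h" for h :: "('k \<Rightarrow>\<^sub>0 real) \<Rightarrow> 'v"
  proof -
    have "h x = h (lin_ext (\<lambda>k. Poly_Mapping.single k 1) x)"
      by (simp add: lin_ext_single_id)
    then show ?thesis
      by (simp add: lin_ext_def linear_sum[OF that] linear_scale[OF that])
  qed
  from this[OF assms(1)] this[OF assms(2)] assms(3) show ?thesis by simp
qed

text \<open>Keeps iterated brackets supported in the alphabet, so that the bracket axioms can be
  applied to them again.\<close>

lemma keys_lin_ext_subset:
  assumes "\<And>k. k \<in> Poly_Mapping.keys x \<Longrightarrow> Poly_Mapping.keys (g k) \<subseteq> S"
  shows "Poly_Mapping.keys (lin_ext g x :: 'b \<Rightarrow>\<^sub>0 real) \<subseteq> S"
proof
  fix j assume "j \<in> Poly_Mapping.keys (lin_ext g x)"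
  then have "(\<Sum>k\<in>Poly_Mapping.keys x. Poly_Mapping.lookup x k * Poly_Mapping.lookup (g k) j) \<noteq> 0"
    by (simp add: in_keys_iff lin_ext_def lookup_sum lookup_scaleR)
  then obtain k where k: "k \<in> Poly_Mapping.keys x" "Poly_Mapping.lookup (g k) j \<noteq> 0"
    by (metis (no_types, lifting) mult_zero_right sum.neutral)
  then have "j \<in> Poly_Mapping.keys (g k)" by (simp add: in_keys_iff)
  with assms[OF k(1)] show "j \<in> S" by blast
qed

lemma linear_bilin_ext: "linear (\<lambda>x. bilin_ext g x y)" "linear (bilin_ext g x)"
proof -
  show "linear (\<lambda>x. bilin_ext g x y)"
    unfolding bilin_ext_def by (rule linear_lin_ext)
  show "linear (bilin_ext g x)"
    by (rule linearI) (simp_all add: bilin_ext_def lin_ext_fun_add lin_ext_fun_scale)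
qed

section \<open>Concatenation and quasi-shuffle of arbitrary elements\<close>

lemmas linear_concat_prod = linear_bilin_ext[of "\<lambda>u v. word (u @ v)", folded concat_prod_def]
lemmas linear_qshuffle = linear_bilin_ext[of "qshuffle_word br" for br, folded qshuffle_def]

lemma linear_letters: "linear letters"
  unfolding letters_def by (rule linear_lin_ext)

lemmas bilinear_simps =
  linear_bilin_ext[THEN linear_add] linear_bilin_ext[THEN linear_scale]
  linear_concat_prod[THEN linear_add] linear_concat_prod[THEN linear_scale]
  linear_qshuffle[THEN linear_add] linear_qshuffle[THEN linear_scale]
  linear_qshuffle[THEN linear_neg] linear_qshuffle[THEN linear_0]
  linear_letters[THEN linear_add] linear_letters[THEN linear_scale]

lemma concat_prod_word [simp]: "concat_prod (word u) (word v) = word (u @ v)"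
  by (simp add: concat_prod_def bilin_ext_def)

lemma qshuffle_word_word: "qshuffle br (word u) (word v) = qshuffle_word br u v"
  by (simp add: qshuffle_def bilin_ext_def)

lemma letters_single [simp]: "letters (Poly_Mapping.single a 1) = word [a]"
  by (simp add: letters_def)

lemma bilin_ext_single [simp]:
  "bilin_ext g (Poly_Mapping.single a 1) (Poly_Mapping.single b 1) = g a b"
  by (simp add: bilin_ext_def)

text \<open>On words this is associativity of appending. The arguments are reduced to words one
  after the other, the last one first, since each reduction uses linearity in a single
  variable.\<close>

lemma concat_prod_assoc:
  "concat_prod (concat_prod x y) z = concat_prod x (concat_prod y z)"
proof -
  have 1: "concat_prod (word (u @ v)) z = concat_prod (word u) (concat_prod (word v) z)" for u v
    by (rule linear_eq_on_keys[of _ _ z]; (rule linearI)?)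
       (simp_all add: bilinear_simps flip: word_def)
  have 2: "concat_prod (concat_prod (word u) y) z = concat_prod (word u) (concat_prod y z)" for u
    by (rule linear_eq_on_keys[of "\<lambda>y. concat_prod (concat_prod (word u) y) z" "\<lambda>y. concat_prod (word u) (concat_prod y z)"];
        (rule linearI)?) (simp_all add: bilinear_simps 1 flip: word_def)
  show ?thesis
    by (rule linear_eq_on_keys[of "\<lambda>x. concat_prod (concat_prod x y) z" "\<lambda>x. concat_prod x (concat_prod y z)"];
        (rule linearI)?) (simp_all add: bilinear_simps 2 flip: word_def)
qed

lemma concat_prod_Nil [simp]: "concat_prod (word []) x = x" "concat_prod x (word []) = x"
proof -
  show "concat_prod (word []) x = x"
    by (rule linear_eq_on_keys[of _ "\<lambda>x. x"]; (rule linearI)?)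
       (simp_all add: bilinear_simps flip: word_def)
  show "concat_prod x (word []) = x"
    by (rule linear_eq_on_keys[of "\<lambda>x. concat_prod x (word [])" "\<lambda>x. x"]; (rule linearI)?)
       (simp_all add: bilinear_simps flip: word_def)
qed

lemma qshuffle_Nil [simp]: "qshuffle br (word []) x = x" "qshuffle br x (word []) = x"
proof -
  show "qshuffle br (word []) x = x"
    by (rule linear_eq_on_keys[of _ "\<lambda>x. x"]; (rule linearI)?)
       (simp_all add: bilinear_simps qshuffle_word_word qshuffle_word_Nil flip: word_def)
  show "qshuffle br x (word []) = x"
    by (rule linear_eq_on_keys[of "\<lambda>x. qshuffle br x (word [])" "\<lambda>x. x"]; (rule linearI)?)
       (simp_all add: bilinear_simps qshuffle_word_word qshuffle_word_Nil flip: word_def)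
qed

lemma foldr_concat_prod_snoc:
  "foldr concat_prod (xs @ [x]) (word []) = concat_prod (foldr concat_prod xs (word [])) x"
  by (induction xs) (simp_all add: concat_prod_assoc)

text \<open>The recursion on last letters is linear in the last letter of the second factor and in
  what precedes it. A combination \<open>c\<close> in place of that letter is what the antipode
  requires, since its terms end in an iterated bracket.\<close>

lemma qshuffle_snoc:
  "qshuffle br (word (u @ [a])) (concat_prod x (letters c)) =
     concat_prod (qshuffle br (word u) (concat_prod x (letters c))) (word [a])
   + concat_prod (qshuffle br (word (u @ [a])) x) (letters c)
   + concat_prod (qshuffle br (word u) x) (letters (bilin_ext br (Poly_Mapping.single a 1) c))"
    (is "?L x c = ?R x c")
proof -
  have 1: "?L (word v) c = ?R (word v) c" for v
    by (rule linear_eq_on_keys[of "?L (word v)" "?R (word v)"]; (rule linearI)?)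
       (simp_all add: bilinear_simps qshuffle_word_word qshuffle_word_snoc algebra_simps)
  show ?thesis
    by (rule linear_eq_on_keys[of "\<lambda>x. ?L x c" "\<lambda>x. ?R x c"]; (rule linearI)?)
       (simp_all add: bilinear_simps 1 algebra_simps flip: word_def)
qed

section \<open>The quasi-shuffle antipode\<close>

abbreviation splits :: "'a list \<Rightarrow> ('a list \<times> 'a list) set" where
  "splits w \<equiv> {(u, v). u @ v = w}"

lemma splits_Cons: "splits (a # w) = insert ([], a # w) (map_prod (Cons a) id ` splits w)"
  by (auto simp: Cons_eq_append_conv append_eq_Cons_conv image_iff)

lemma finite_splits: "finite (splits w)"
  by (induction w) (simp_all add: splits_Cons)

lemma sum_splits_Nil: "(\<Sum>(u, v)\<in>splits []. f u v) = f [] []"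
proof -
  have "splits ([] :: 'a list) = {([], [])}" by auto
  then show ?thesis by simp
qed

lemma sum_splits_Cons:
  "(\<Sum>(u, v)\<in>splits (a # w). f u v) = f [] (a # w) + (\<Sum>(u, v)\<in>splits w. f (a # u) v)"
proof -
  have "inj_on (map_prod (Cons a) id) (splits w)"
    by (auto simp: inj_on_def)
  then have "(\<Sum>(u, v)\<in>map_prod (Cons a) id ` splits w. f u v) = (\<Sum>(u, v)\<in>splits w. f (a # u) v)"
    by (simp add: sum.reindex case_prod_unfold)
  then show ?thesis
    unfolding splits_Cons by (subst sum.insert) (auto intro: finite_imageI finite_splits)
qed

section \<open>Factorizations into nonempty blocks\<close>

definition block_factorizations :: "'a list \<Rightarrow> 'a list list set" where
  "block_factorizations w = {us. concat us = w \<and> [] \<notin> set us}"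

lemma block_factorizations_Nil: "block_factorizations [] = {[]}"
proof -
  have "us = []" if "concat us = []" "[] \<notin> set us" for us :: "'a list list"
    using that by (cases us) auto
  then show ?thesis by (auto simp: block_factorizations_def)
qed

text \<open>The last block of a factorization of \<open>rev (a # v)\<close> ends in
  \<open>a\<close>. Its other letters form \<open>rev x\<close> for a prefix \<open>x\<close> of
  \<open>v\<close>, and the earlier blocks factor the reversal of the remaining suffix
  \<open>y\<close>.\<close>

lemma block_factorizations_rev_Cons:
  "block_factorizations (rev (a # v)) =
     (\<Union>(x, y)\<in>splits v. (\<lambda>us. us @ [rev x @ [a]]) ` block_factorizations (rev y))"
proof (intro equalityI subsetI)
  fix us assume us: "us \<in> block_factorizations (rev (a # v))"
  then have "us \<noteq> []" by (auto simp: block_factorizations_def)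
  then obtain us' z where usz: "us = us' @ [z]" by (metis rev_exhaust)
  with us have z: "z \<noteq> []" "concat us' @ z = rev v @ [a]" "[] \<notin> set us'"
    by (auto simp: block_factorizations_def)
  then obtain z' b where "z = z' @ [b]" by (metis rev_exhaust)
  with z have zz: "z = z' @ [a]" "concat us' @ z' = rev v" by auto
  then have "(rev z', rev (concat us')) \<in> splits v"
    by (simp flip: rev_append)
  moreover have "us \<in> (\<lambda>us. us @ [rev (rev z') @ [a]]) ` block_factorizations (rev (rev (concat us')))"
    using usz zz z by (auto simp: block_factorizations_def)
  ultimately show "us \<in> (\<Union>(x, y)\<in>splits v. (\<lambda>us. us @ [rev x @ [a]]) ` block_factorizations (rev y))"
    by blast
qed (auto simp: block_factorizations_def)

text \<open>The recursion passes to arbitrary suffixes, hence the induction on length; it speaks of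
  reversed words, and every word is one.\<close>

lemma finite_block_factorizations: "finite (block_factorizations w)"
proof -
  have "finite (block_factorizations (rev v))" for v :: "'a list"
  proof (induction v rule: length_induct)
    case (1 v)
    show ?case
    proof (cases v)
      case (Cons a v')
      show ?thesis
        unfolding Cons block_factorizations_rev_Cons
        using 1 Cons by (intro finite_UN_I finite_splits) auto
    qed (simp add: block_factorizations_Nil)
  qed
  from this[of "rev w"] show ?thesis by simp
qed

text \<open>The quasi-shuffle antipode without its sign, which depends only on the length and would
  clutter the recursion on the last block.\<close>

definition rev_blocks :: "('a \<Rightarrow> 'a \<Rightarrow> ('a \<Rightarrow>\<^sub>0 real)) \<Rightarrow> 'a list \<Rightarrow> 'a words" where
  "rev_blocks br w = (\<Sum>us\<in>block_factorizations (rev w).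
     foldr concat_prod (map (\<lambda>u. letters (iter_bracket br u)) us) (word []))"

lemma qs_antipode_word: "qs_antipode br (word w) = (-1) ^ length w *\<^sub>R rev_blocks br w"
  by (simp add: qs_antipode_def rev_blocks_def block_factorizations_def)

lemma rev_blocks_Nil [simp]: "rev_blocks br [] = word []"
  by (simp add: rev_blocks_def block_factorizations_Nil)

lemma rev_blocks_Cons:
  "rev_blocks br (a # v) =
     (\<Sum>(x, y)\<in>splits v. concat_prod (rev_blocks br y) (letters (iter_bracket br (rev x @ [a]))))"
proof -
  let ?t = "\<lambda>us. foldr concat_prod (map (\<lambda>u. letters (iter_bracket br u)) us) (word [])"
  \<comment> \<open>Different splittings give different last blocks, so the union is
    disjoint.\<close>
  have "rev_blocks br (a # v) = (\<Sum>xy\<in>splits v.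
      \<Sum>us\<in>(\<lambda>us. us @ [rev (fst xy) @ [a]]) ` block_factorizations (rev (snd xy)). ?t us)"
    unfolding rev_blocks_def block_factorizations_rev_Cons case_prod_unfold
    by (intro sum.UNION_disjoint)
       (auto simp: finite_splits[unfolded case_prod_unfold] finite_block_factorizations)
  also have "\<dots> = (\<Sum>xy\<in>splits v. \<Sum>us\<in>block_factorizations (rev (snd xy)).
      concat_prod (?t us) (letters (iter_bracket br (rev (fst xy) @ [a]))))"
    by (rule sum.cong[OF refl], subst sum.reindex)
       (auto simp: inj_on_def foldr_concat_prod_snoc simp del: foldr_append)
  also have "\<dots> = (\<Sum>xy\<in>splits v.
      concat_prod (rev_blocks br (snd xy)) (letters (iter_bracket br (rev (fst xy) @ [a]))))"
    by (simp add: rev_blocks_def linear_sum[OF linear_concat_prod(1)])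
  finally show ?thesis by (simp add: case_prod_unfold)
qed

text \<open>Separates the algebra from the probabilistic setting, so that the zero bracket on all
  letters is an instance too. The axioms are relative to \<open>A\<close>, as the bracket of the
  driving processes is constrained only on the alphabet.\<close>

locale bracket_algebra =
  fixes A :: "'a set" and br :: "'a \<Rightarrow> 'a \<Rightarrow> ('a \<Rightarrow>\<^sub>0 real)"
  assumes closed: "\<And>a b. a \<in> A \<Longrightarrow> b \<in> A \<Longrightarrow> Poly_Mapping.keys (br a b) \<subseteq> A"
    and commute: "\<And>a b. a \<in> A \<Longrightarrow> b \<in> A \<Longrightarrow> br a b = br b a"
    and assoc: "\<And>a b c. a \<in> A \<Longrightarrow> b \<in> A \<Longrightarrow> c \<in> A \<Longrightarrow>
      bilin_ext br (br a b) (Poly_Mapping.single c 1)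
        = bilin_ext br (Poly_Mapping.single a 1) (br b c)"
begin

lemma keys_iter_bracket: "set w \<subseteq> A \<Longrightarrow> Poly_Mapping.keys (iter_bracket br w) \<subseteq> A"
proof (induction w)
  case (Cons a w)
  note hyp = Cons
  show ?case
  proof (cases w)
    case (Cons b u)
    have "Poly_Mapping.keys (lin_ext (br a) (iter_bracket br w)) \<subseteq> A"
      using hyp by (intro keys_lin_ext_subset closed) auto
    then show ?thesis by (simp add: Cons bilin_ext_def)
  qed (use Cons in simp)
qed simp

text \<open>For a letter c in the support of \<open>x\<close>, [a,[b,c]] = [[a,b],c] = [[b,a],c] =
  [b,[a,c]]; the rest is linearity.\<close>

lemma bracket_left_commute:
  assumes "a \<in> A" "b \<in> A" "Poly_Mapping.keys x \<subseteq> A"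
  shows "bilin_ext br (Poly_Mapping.single a 1) (bilin_ext br (Poly_Mapping.single b 1) x)
       = bilin_ext br (Poly_Mapping.single b 1) (bilin_ext br (Poly_Mapping.single a 1) x)"
proof (rule linear_eq_on_keys[of _ _ x])
  fix c assume "c \<in> Poly_Mapping.keys x"
  with assms have "c \<in> A" by auto
  then have "bilin_ext br (Poly_Mapping.single a 1) (br b c) = bilin_ext br (Poly_Mapping.single b 1) (br a c)"
    using assms by (simp add: commute[of a b] flip: assoc)
  then show "bilin_ext br (Poly_Mapping.single a 1) (bilin_ext br (Poly_Mapping.single b 1) (Poly_Mapping.single c 1))
       = bilin_ext br (Poly_Mapping.single b 1) (bilin_ext br (Poly_Mapping.single a 1) (Poly_Mapping.single c 1))"
    by simp
qed (auto intro!: linearI simp: bilinear_simps)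

text \<open>\<open>iter_bracket\<close> nests to the right, so an appended letter sits innermost.
  Commutativity moves it in front of the last letter, and left commutativity past all the
  others.\<close>

lemma iter_bracket_snoc:
  assumes "v \<noteq> []" "set v \<subseteq> A" "a \<in> A"
  shows "iter_bracket br (v @ [a]) = bilin_ext br (Poly_Mapping.single a 1) (iter_bracket br v)"
  using assms
proof (induction v rule: list_nonempty_induct)
  case (single b)
  then show ?case by (simp add: commute)
next
  case (cons b v)
  obtain c v' where v: "v = c # v'" using cons.hyps by (cases v) auto
  have "iter_bracket br ((b # v) @ [a]) = bilin_ext br (Poly_Mapping.single b 1) (iter_bracket br (v @ [a]))"
    by (simp add: v)
  also have "\<dots> = bilin_ext br (Poly_Mapping.single a 1) (bilin_ext br (Poly_Mapping.single b 1) (iter_bracket br v))"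
    using cons by (simp add: bracket_left_commute[of a b] keys_iter_bracket)
  also have "\<dots> = bilin_ext br (Poly_Mapping.single a 1) (iter_bracket br (b # v))"
    by (simp add: v)
  finally show ?case .
qed

text \<open>Products for neighbouring prefixes share one of these sums, hence the telescoping.\<close>

definition last_block_sum :: "'a list \<Rightarrow> 'a \<Rightarrow> 'a list \<Rightarrow> 'a words" where
  "last_block_sum u a v = (\<Sum>(x, y)\<in>splits v.
     concat_prod (qshuffle br (word u) (rev_blocks br y)) (letters (iter_bracket br (rev x @ [a]))))"

lemma rev_blocks_eq_last_block_sum: "rev_blocks br (a # v) = last_block_sum [] a v"
  by (simp add: rev_blocks_Cons last_block_sum_def)

lemma last_block_sum_Nil: "last_block_sum u a [] = word (u @ [a])"
  unfolding last_block_sum_def sum_splits_Nil by simp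

text \<open>The recursion produces three kinds of terms, ending in \<open>a\<close>, in the last
  block of the antipode, or in the bracket of the two. The first and third kinds are the splittings
  of \<open>b # v\<close> with empty and with nonempty \<open>x\<close>, which make up the first
  sum; the second kind gives the second sum.\<close>

lemma qshuffle_rev_blocks:
  assumes "a \<in> A" "b \<in> A" "set v \<subseteq> A"
  shows "qshuffle br (word (u @ [a])) (rev_blocks br (b # v))
       = last_block_sum u a (b # v) + last_block_sum (u @ [a]) b v"
proof -
  let ?q = "\<lambda>u. qshuffle br (word u)"
  \<comment> \<open>Absorbing \<open>a\<close> turns the block ending in \<open>b\<close> into the
    block of the longer prefix \<open>b # x\<close>. Commutativity and associativity of the bracket
    enter here.\<close>
  have br: "bilin_ext br (Poly_Mapping.single a 1) (iter_bracket br (rev x @ [b]))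
      = iter_bracket br (rev (b # x) @ [a])" if "x @ y = v" for x y
    using assms that by (subst iter_bracket_snoc) auto
  have "?q (u @ [a]) (rev_blocks br (b # v))
    = (\<Sum>(x, y)\<in>splits v. ?q (u @ [a]) (concat_prod (rev_blocks br y) (letters (iter_bracket br (rev x @ [b])))))"
    unfolding rev_blocks_Cons linear_sum[OF linear_qshuffle(2)] by (simp add: case_prod_unfold)
  also have "\<dots> = (\<Sum>(x, y)\<in>splits v.
        concat_prod (?q u (concat_prod (rev_blocks br y) (letters (iter_bracket br (rev x @ [b]))))) (word [a])
      + concat_prod (?q (u @ [a]) (rev_blocks br y)) (letters (iter_bracket br (rev x @ [b])))
      + concat_prod (?q u (rev_blocks br y)) (letters (iter_bracket br (rev (b # x) @ [a]))))"
    by (rule sum.cong) (auto simp: qshuffle_snoc br simp del: rev.simps)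
  also have "\<dots> = concat_prod (?q u (rev_blocks br (b # v))) (word [a]) + last_block_sum (u @ [a]) b v
      + (\<Sum>(x, y)\<in>splits v. concat_prod (?q u (rev_blocks br y)) (letters (iter_bracket br (rev (b # x) @ [a]))))"
    unfolding rev_blocks_Cons linear_sum[OF linear_qshuffle(2)] linear_sum[OF linear_concat_prod(1)] last_block_sum_def
    by (simp add: case_prod_unfold sum.distrib)
  also have "\<dots> = last_block_sum u a (b # v) + last_block_sum (u @ [a]) b v"
    unfolding last_block_sum_def[of u a] sum_splits_Cons by simp
  finally show ?thesis .
qed

text \<open>The splitting with empty \<open>x\<close> contributes two neighbouring sums. By the
  induction hypothesis for the prefix \<open>u @ [a]\<close>, the other splittings add up to the
  second of these with the opposite sign, so only the first survives.\<close>

lemma alternating_sum_last_block: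
  assumes "a \<in> A" "set v \<subseteq> A"
  shows "(\<Sum>(x, y)\<in>splits v. qshuffle br (word (u @ [a] @ x)) ((-1) ^ length y *\<^sub>R rev_blocks br y))
       = (-1) ^ length v *\<^sub>R last_block_sum u a v"
  using assms
proof (induction v arbitrary: u a)
  case Nil
  show ?case unfolding sum_splits_Nil by (simp add: last_block_sum_Nil)
next
  case (Cons b v)
  have 1: "(\<Sum>(x, y)\<in>splits v. qshuffle br (word (u @ [a] @ b # x)) ((-1) ^ length y *\<^sub>R rev_blocks br y))
       = (-1) ^ length v *\<^sub>R last_block_sum (u @ [a]) b v"
    using Cons.IH[of b "u @ [a]"] Cons.prems by simp
  have 2: "qshuffle br (word (u @ [a] @ [])) ((-1) ^ length (b # v) *\<^sub>R rev_blocks br (b # v))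
       = (-1) ^ length (b # v) *\<^sub>R (last_block_sum u a (b # v) + last_block_sum (u @ [a]) b v)"
    using Cons.prems qshuffle_rev_blocks[of a b v u]
    by (simp only: linear_scale[OF linear_qshuffle(2)]) simp
  show ?case
    unfolding sum_splits_Cons 1 2 by (simp add: scaleR_add_right)
qed

text \<open>The splittings with nonempty prefix telescope to the unsigned antipode of
  \<open>w\<close>. The empty prefix gives the antipode itself, with the opposite sign.\<close>

lemma qs_antipode_convolution:
  assumes "set w \<subseteq> A" "w \<noteq> []"
  shows "(\<Sum>(u, v)\<in>splits w. qshuffle br (word u) (qs_antipode br (word v))) = 0"
proof (cases w)
  case (Cons a v)
  have 1: "(\<Sum>(x, y)\<in>splits v. qshuffle br (word (a # x)) ((-1) ^ length y *\<^sub>R rev_blocks br y))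
       = (-1) ^ length v *\<^sub>R rev_blocks br (a # v)"
    using alternating_sum_last_block[of a v "[]"] assms
    by (simp add: Cons rev_blocks_eq_last_block_sum)
  show ?thesis
    unfolding Cons sum_splits_Cons qs_antipode_word 1 by simp
qed (use assms in simp)

end

section \<open>Convolution powers and coshlog\<close>

lemma conv_unit_word: "conv_unit (word w) = (if w = [] then word [] else 0)"
  by (simp add: conv_unit_def)

lemma augm_word: "augm (word w) = (if w = [] then 0 else word w)"
  by (simp add: augm_def conv_unit_word)

lemma convol_word: "convol m X Y (word w) = (\<Sum>(u, v)\<in>splits w. m (X (word u)) (Y (word v)))"
  by (simp add: convol_def)

lemma conv_power_Suc_Nil: "conv_power (qshuffle br) augm (Suc k) (word []) = 0"
  unfolding conv_power.simps convol_word sum_splits_Nil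
  by (simp add: augm_word bilinear_simps)

text \<open>As \<open>augm\<close> kills the empty word, the first letter always goes into the first
  factor.\<close>

lemma conv_power_Suc_Cons:
  "conv_power (qshuffle br) augm (Suc k) (word (a # w)) =
     (\<Sum>(u, v)\<in>splits w. qshuffle br (word (a # u)) (conv_power (qshuffle br) augm k (word v)))"
  unfolding conv_power.simps convol_word sum_splits_Cons
  by (simp add: augm_word bilinear_simps)

text \<open>Each of the \<open>k\<close> factors takes up at least one letter. Hence the series in
  \<open>coshlog\<close> is a finite sum on every word.\<close>

lemma conv_power_eq_0:
  "length w < k \<Longrightarrow> conv_power (qshuffle br) augm k (word w) = 0"
proof (induction k arbitrary: w)
  case (Suc k)
  show ?case
  proof (cases w)
    case (Cons a v)
    with Suc show ?thesis
      unfolding Cons conv_power_Suc_Cons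
      by (intro sum.neutral) (auto simp: bilinear_simps)
  qed (simp add: conv_power_Suc_Nil del: conv_power.simps)
qed simp

text \<open>Only the empty suffix survives. The function \<open>f\<close> is arbitrary because the
  induction absorbs the first letter of the word into it.\<close>

lemma sum_splits_conv_unit:
  "(\<Sum>(u, v)\<in>splits w. qshuffle br (f u) (conv_unit (word v))) = f w"
proof (induction w arbitrary: f)
  case Nil
  show ?case unfolding sum_splits_Nil by (simp add: conv_unit_word)
next
  case (Cons b w)
  show ?case unfolding sum_splits_Cons Cons.IH by (simp add: conv_unit_word bilinear_simps)
qed

lemma conv_power_1:
  assumes "w \<noteq> []"
  shows "conv_power (qshuffle br) augm (Suc 0) (word w) = word w"
  using assms by (simp add: convol_word sum_splits_conv_unit augm_word)

context bracket_algebra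
begin

text \<open>Splitting off the power 0 writes the truncated Neumann series as the unit minus the
  convolution of \<open>augm\<close> with the series truncated one step earlier. The antipode
  satisfies the same recursion by \<open>qs_antipode_convolution\<close>.\<close>

lemma alternating_conv_powers_eq_qs_antipode:
  assumes "set w \<subseteq> A" "length w \<le> N"
  shows "(\<Sum>k\<le>N. (-1) ^ k *\<^sub>R conv_power (qshuffle br) augm k (word w)) = qs_antipode br (word w)"
  using assms
proof (induction N arbitrary: w)
  case 0
  then show ?case by (simp add: conv_unit_word qs_antipode_word)
next
  case (Suc N)
  let ?P = "conv_power (qshuffle br) augm"
  have "(\<Sum>k\<le>Suc N. (-1) ^ k *\<^sub>R ?P k (word w))
      = conv_unit (word w) - (\<Sum>k\<le>N. (-1) ^ k *\<^sub>R ?P (Suc k) (word w))"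
    by (simp add: sum.atMost_Suc_shift sum_negf del: sum.atMost_Suc conv_power.simps(2))
  also have "\<dots> = qs_antipode br (word w)"
  proof (cases w)
    case Nil
    then show ?thesis
      by (simp add: conv_unit_word qs_antipode_word conv_power_Suc_Nil del: conv_power.simps)
  next
    case (Cons a w')
    have "(\<Sum>k\<le>N. (-1) ^ k *\<^sub>R ?P (Suc k) (word w))
        = (\<Sum>(u, v)\<in>splits w'. \<Sum>k\<le>N. qshuffle br (word (a # u)) ((-1) ^ k *\<^sub>R ?P k (word v)))"
      unfolding Cons conv_power_Suc_Cons case_prod_unfold
      by (subst sum.swap) (simp add: scaleR_sum_right linear_scale[OF linear_qshuffle(2)])
    \<comment> \<open>The letter \<open>a\<close> lies in the prefix, so \<open>v\<close> has length
      at most \<open>N\<close> and the induction hypothesis applies.\<close>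
    also have "\<dots> = (\<Sum>(u, v)\<in>splits w'. qshuffle br (word (a # u)) (qs_antipode br (word v)))"
      using Suc Cons
      by (intro sum.cong) (auto simp flip: linear_sum[OF linear_qshuffle(2)])
    \<comment> \<open>The empty prefix in the vanishing convolution contributes the antipode of
      \<open>w\<close> itself.\<close>
    finally show ?thesis
      using qs_antipode_convolution[of w] Suc.prems
      unfolding Cons sum_splits_Cons by (simp add: conv_unit_word add_eq_0_iff)
  qed
  finally show ?case .
qed

text \<open>The series in \<open>coshlog\<close> starts at the power 2. On a nonempty word the
  powers 0 and 1 contribute 0 and \<open>- word w\<close> to the Neumann series, so leaving them out
  adds \<open>word w\<close> to the antipode.\<close>

lemma coshlog_qshuffle_word:
  assumes "set w \<subseteq> A" "w \<noteq> []"
  shows "coshlog (qshuffle br) (word w) = (1/2) *\<^sub>R (word w + qs_antipode br (word w))"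
proof -
  let ?g = "\<lambda>k. (-1) ^ k *\<^sub>R conv_power (qshuffle br) augm k (word w)"
  let ?N = "length w"
  have "Sum_any (\<lambda>k. if 2 \<le> k then ?g k else 0) = (\<Sum>k\<le>?N. if 2 \<le> k then ?g k else 0)"
    by (rule Sum_any.expand_superset) (auto intro: leI simp: conv_power_eq_0)
  also have "\<dots> = (\<Sum>k\<le>?N. ?g k) - (\<Sum>k\<le>?N. if k < 2 then ?g k else 0)"
    by (subst sum_subtractf[symmetric]) (rule sum.cong, auto)
  \<comment> \<open>A nonempty word has length at least 1, so both indices 0 and 1 are in
    range.\<close>
  also have "(\<Sum>k\<le>?N. if k < 2 then ?g k else 0) = (\<Sum>k\<in>{0, 1}. ?g k)"
    using assms(2) by (intro sum.mono_neutral_cong_right) (auto simp: Suc_le_eq)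
  also have "\<dots> = - word w"
    using conv_power_1[OF assms(2)] assms(2) by (simp add: conv_unit_word)
  finally show ?thesis
    using assms by (simp add: coshlog_def conv_unit_word alternating_conv_powers_eq_qs_antipode add.commute)
qed

end

text \<open>With the zero bracket every block of two or more letters vanishes, and only the
  factorization into single letters remains.\<close>

lemma rev_blocks_shuffle: "rev_blocks (\<lambda>a b. 0) w = word (rev w)"
proof (induction w)
  case (Cons a v)
  have [simp]: "bilin_ext (\<lambda>a b. 0) x y = 0" for x y :: "'a \<Rightarrow>\<^sub>0 real"
    by (simp add: bilin_ext_def lin_ext_def)
  \<comment> \<open>The block has at least two letters; the case distinctions expose the first two
    of them.\<close>
  have 0: "iter_bracket (\<lambda>a b. 0) (rev (b # x) @ [a]) = 0" for b x
    by (cases "rev x"; cases "tl (rev x)") auto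
  show ?case
  proof (cases v)
    case Nil
    then show ?thesis
      unfolding Nil rev_blocks_Cons sum_splits_Nil by simp
  next
    case (Cons b v')
    have "rev_blocks (\<lambda>a b. 0) (a # v) = concat_prod (rev_blocks (\<lambda>a b. 0) v) (word [a])"
      unfolding rev_blocks_Cons Cons sum_splits_Cons 0 
      by (simp add: linear_0[OF linear_letters] linear_0[OF linear_concat_prod(2)])
    with Cons.IH show ?thesis by simp
  qed
qed simp

lemma qs_antipode_shuffle_word: "qs_antipode (\<lambda>a b. 0) (word w) = sign_rev (word w)"
  by (simp add: qs_antipode_word rev_blocks_shuffle sign_rev_def)

lemma coshlog_shuffle_word:
  assumes "w \<noteq> []"
  shows "coshlog shuffle (word w) = (1/2) *\<^sub>R (word w + sign_rev (word w))"
proof -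
  interpret bracket_algebra UNIV "\<lambda>a b. 0"
    by unfold_locales (simp_all add: linear_0[OF linear_bilin_ext(1)] linear_0[OF linear_bilin_ext(2)])
  show ?thesis
    unfolding shuffle_def using coshlog_qshuffle_word[of w] assms
    by (simp add: qs_antipode_shuffle_word)
qed

text \<open>Sign reversal preserves length, so the projection to level \<open>n + 1\<close> keeps or
  kills both terms together. On that level \<open>augm\<close> is the identity, and subtracting half
  the difference leaves half the sum.\<close>

lemma antisym_sign_rev_map_word:
  "antisym_sign_rev_map n (word w) =
     (if length w \<le> n then word w
      else if length w = n + 1 then (1/2) *\<^sub>R (word w + sign_rev (word w)) else 0)"
proof -
  have "augm (word w) - (1/2) *\<^sub>R (word w - sign_rev (word w)) = (1/2) *\<^sub>R (word w + sign_rev (word w))"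
    if "w \<noteq> []"
  proof -
    have "word w - (1/2) *\<^sub>R word w = (1/2) *\<^sub>R word w"
      using scaleR_left_diff_distrib[of 1 "1/2" "word w"] by simp
    then show ?thesis using that
      by (simp add: augm_word scaleR_add_right scaleR_diff_right)
  qed
  then show ?thesis
    by (auto simp: antisym_sign_rev_map_def direct_mti_def proj_words_def augm_word sign_rev_def)
qed

section \<open>Unconditional sums in probability\<close>

text \<open>Brings subsums over different index sets onto the single filter of \<open>U\<close>,
  where their limits can be added. A finite \<open>Y\<close> in \<open>B\<close> containing
  \<open>X \<inter> B\<close> is the trace on \<open>B\<close> of
  \<open>X \<union> Y\<close>.\<close>

lemma filtermap_Int_finite_subsets_at_top:
  assumes "B \<subseteq> U"
  shows "filtermap (\<lambda>F. F \<inter> B) (finite_subsets_at_top U) = finite_subsets_at_top B"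
proof (rule filter_eqI)
  fix P
  show "eventually P (filtermap (\<lambda>F. F \<inter> B) (finite_subsets_at_top U)) \<longleftrightarrow>
    eventually P (finite_subsets_at_top B)"
  proof
    assume "eventually P (filtermap (\<lambda>F. F \<inter> B) (finite_subsets_at_top U))"
    then obtain X where X: "finite X" "X \<subseteq> U"
      and P: "\<And>Y. finite Y \<Longrightarrow> X \<subseteq> Y \<Longrightarrow> Y \<subseteq> U \<Longrightarrow> P (Y \<inter> B)"
      by (auto simp: eventually_filtermap eventually_finite_subsets_at_top)
    have "P Y" if "finite Y" "X \<inter> B \<subseteq> Y" "Y \<subseteq> B" for Y
    proof -
      have "(X \<union> Y) \<inter> B = Y" using that by auto
      then show ?thesis using P[of "X \<union> Y"] X assms that by auto
    qed
    then show "eventually P (finite_subsets_at_top B)"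
      unfolding eventually_finite_subsets_at_top using X by (intro exI[of _ "X \<inter> B"]) auto
  next
    assume "eventually P (finite_subsets_at_top B)"
    then obtain X where X: "finite X" "X \<subseteq> B"
      and P: "\<And>Y. finite Y \<Longrightarrow> X \<subseteq> Y \<Longrightarrow> Y \<subseteq> B \<Longrightarrow> P Y"
      by (auto simp: eventually_finite_subsets_at_top)
    show "eventually P (filtermap (\<lambda>F. F \<inter> B) (finite_subsets_at_top U))"
      unfolding eventually_filtermap eventually_finite_subsets_at_top
      using X P assms by (intro exI[of _ X]) auto
  qed
qed

section \<open>Convergence in probability\<close>

lemma tendsto_probD:
  assumes "tendsto_prob M X L F" "0 < \<epsilon>"
  shows "((\<lambda>i. measure M {\<omega> \<in> space M. \<epsilon> < \<bar>X i \<omega> - L \<omega>\<bar>}) \<longlongrightarrow> 0) F"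
  using assms by (simp add: tendsto_prob_def)

lemma tendsto_prob_filtermap:
  "tendsto_prob M X L (filtermap g F) \<longleftrightarrow> tendsto_prob M (\<lambda>i. X (g i)) L F"
  by (simp add: tendsto_prob_def filterlim_filtermap)

lemma tendsto_prob_cong:
  assumes "\<And>\<omega>. \<omega> \<in> space M \<Longrightarrow> L \<omega> = L' \<omega>"
    and "eventually (\<lambda>i. \<forall>\<omega>\<in>space M. X i \<omega> = X' i \<omega>) F"
  shows "tendsto_prob M X L F \<longleftrightarrow> tendsto_prob M X' L' F"
proof -
  have "eventually (\<lambda>i. measure M {\<omega> \<in> space M. \<epsilon> < \<bar>X i \<omega> - L \<omega>\<bar>}
      = measure M {\<omega> \<in> space M. \<epsilon> < \<bar>X' i \<omega> - L' \<omega>\<bar>}) F" for \<epsilon>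
    using assms(2) by eventually_elim (intro arg_cong[of _ _ "measure M"], auto simp: assms(1))
  from tendsto_cong[OF this] show ?thesis
    unfolding tendsto_prob_def
    using measurable_cong[of M L L' borel, OF assms(1)] by auto
qed

lemma tendsto_prob_minus:
  assumes "tendsto_prob M X L F"
  shows "tendsto_prob M (\<lambda>i \<omega>. - X i \<omega>) (\<lambda>\<omega>. - L \<omega>) F"
  using assms by (simp add: tendsto_prob_def abs_minus_commute)

lemma (in prob_space) prob_dist_triangle:
  fixes X Y Z :: "'a \<Rightarrow> real"
  assumes [measurable]: "X \<in> borel_measurable M" "Y \<in> borel_measurable M" "Z \<in> borel_measurable M"
  shows "prob {\<omega> \<in> space M. \<delta> + \<epsilon> < \<bar>X \<omega> - Z \<omega>\<bar>}
    \<le> prob {\<omega> \<in> space M. \<delta> < \<bar>X \<omega> - Y \<omega>\<bar>} + prob {\<omega> \<in> space M. \<epsilon> < \<bar>Y \<omega> - Z \<omega>\<bar>}"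
proof -
  have "\<delta> < \<bar>X \<omega> - Y \<omega>\<bar> \<or> \<epsilon> < \<bar>Y \<omega> - Z \<omega>\<bar>" if "\<delta> + \<epsilon> < \<bar>X \<omega> - Z \<omega>\<bar>" for \<omega>
    using that by linarith
  then have "prob {\<omega> \<in> space M. \<delta> + \<epsilon> < \<bar>X \<omega> - Z \<omega>\<bar>}
    \<le> prob ({\<omega> \<in> space M. \<delta> < \<bar>X \<omega> - Y \<omega>\<bar>} \<union> {\<omega> \<in> space M. \<epsilon> < \<bar>Y \<omega> - Z \<omega>\<bar>})"
    by (intro finite_measure_mono) (blast, measurable)
  also have "\<dots> \<le> prob {\<omega> \<in> space M. \<delta> < \<bar>X \<omega> - Y \<omega>\<bar>} + prob {\<omega> \<in> space M. \<epsilon> < \<bar>Y \<omega> - Z \<omega>\<bar>}"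
    by (rule measure_Un_le) measurable
  finally show ?thesis .
qed

text \<open>\<open>tendsto_prob\<close> does not make the approximants measurable, yet subadditivity
  is applied to their level sets. Measurability is asked only eventually because finite sums are
  known to be measurable only for index sets inside \<open>U\<close>.\<close>

lemma (in prob_space) tendsto_prob_add:
  assumes X: "tendsto_prob M X L F" and Y: "tendsto_prob M Y K F"
    and X_meas: "eventually (\<lambda>i. X i \<in> borel_measurable M) F"
    and Y_meas: "eventually (\<lambda>i. Y i \<in> borel_measurable M) F"
  shows "tendsto_prob M (\<lambda>i \<omega>. X i \<omega> + Y i \<omega>) (\<lambda>\<omega>. L \<omega> + K \<omega>) F"
  unfolding tendsto_prob_def
proof (intro conjI allI impI)
  have [measurable]: "L \<in> borel_measurable M" "K \<in> borel_measurable M"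
    using X Y by (auto simp: tendsto_prob_def)
  show "(\<lambda>\<omega>. L \<omega> + K \<omega>) \<in> borel_measurable M" by measurable
  fix \<epsilon> :: real assume "0 < \<epsilon>"
  then have "((\<lambda>i. prob {\<omega> \<in> space M. \<epsilon>/2 < \<bar>X i \<omega> - L \<omega>\<bar>} + prob {\<omega> \<in> space M. \<epsilon>/2 < \<bar>Y i \<omega> - K \<omega>\<bar>}) \<longlongrightarrow> 0 + 0) F"
    using X Y by (intro tendsto_add tendsto_probD) simp_all
  then have lim: "((\<lambda>i. prob {\<omega> \<in> space M. \<epsilon>/2 < \<bar>X i \<omega> - L \<omega>\<bar>} + prob {\<omega> \<in> space M. \<epsilon>/2 < \<bar>Y i \<omega> - K \<omega>\<bar>}) \<longlongrightarrow> 0) F"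
    by simp
  show "((\<lambda>i. prob {\<omega> \<in> space M. \<epsilon> < \<bar>X i \<omega> + Y i \<omega> - (L \<omega> + K \<omega>)\<bar>}) \<longlongrightarrow> 0) F"
  proof (rule tendsto_sandwich[OF _ _ tendsto_const lim])
    show "eventually (\<lambda>i. prob {\<omega> \<in> space M. \<epsilon> < \<bar>X i \<omega> + Y i \<omega> - (L \<omega> + K \<omega>)\<bar>}
      \<le> prob {\<omega> \<in> space M. \<epsilon>/2 < \<bar>X i \<omega> - L \<omega>\<bar>} + prob {\<omega> \<in> space M. \<epsilon>/2 < \<bar>Y i \<omega> - K \<omega>\<bar>}) F"
      using X_meas Y_meas
    proof eventually_elim
      case (elim i)
      note [measurable] = elim
      show ?case
        using prob_dist_triangle[of "\<lambda>\<omega>. X i \<omega> + Y i \<omega>" "\<lambda>\<omega>. L \<omega> + Y i \<omega>" "\<lambda>\<omega>. L \<omega> + K \<omega>" "\<epsilon>/2" "\<epsilon>/2"]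
        by simp
    qed
  qed simp
qed

text \<open>The probabilities are integrals of indicators bounded by 1 that tend to 0 almost
  everywhere, so dominated convergence applies.\<close>

lemma (in prob_space) AE_LIMSEQ_imp_tendsto_prob:
  fixes S :: "nat \<Rightarrow> 'a \<Rightarrow> real"
  assumes [measurable]: "\<And>n. S n \<in> borel_measurable M" "L \<in> borel_measurable M"
    and AE: "AE \<omega> in M. (\<lambda>n. S n \<omega>) \<longlonglongrightarrow> L \<omega>"
  shows "tendsto_prob M S L sequentially"
  unfolding tendsto_prob_def
proof (intro conjI allI impI)
  fix \<epsilon> :: real assume "0 < \<epsilon>"
  have "(\<lambda>n. \<integral>\<omega>. indicator {\<omega> \<in> space M. \<epsilon> < \<bar>S n \<omega> - L \<omega>\<bar>} \<omega> \<partial>M) \<longlonglongrightarrow> (\<integral>\<omega>. (0::real) \<partial>M)"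
  proof (rule integral_dominated_convergence[where w = "\<lambda>_. 1"])
    show "AE \<omega> in M. (\<lambda>n. indicator {\<omega> \<in> space M. \<epsilon> < \<bar>S n \<omega> - L \<omega>\<bar>} \<omega>) \<longlonglongrightarrow> (0::real)"
      using AE
    proof eventually_elim
      case (elim \<omega>)
      then have "eventually (\<lambda>n. dist (S n \<omega>) (L \<omega>) < \<epsilon>) sequentially"
        using \<open>0 < \<epsilon>\<close> by (rule tendstoD)
      then have "eventually (\<lambda>n. indicator {\<omega> \<in> space M. \<epsilon> < \<bar>S n \<omega> - L \<omega>\<bar>} \<omega> = (0::real)) sequentially"
        by eventually_elim (auto simp: dist_real_def indicator_def)
      then show ?case by (rule tendsto_eventually)
    qed
  qed (auto simp: indicator_def)
  then show "(\<lambda>n. prob {\<omega> \<in> space M. \<epsilon> < \<bar>S n \<omega> - L \<omega>\<bar>}) \<longlonglongrightarrow> 0"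
    by simp
qed fact

text \<open>The geometric rate serves twice: summable probabilities for Borel-Cantelli, and then
  almost surely a summable bound on the increments.\<close>

lemma (in prob_space) tendsto_prob_fast_Cauchy:
  fixes S :: "nat \<Rightarrow> 'a \<Rightarrow> real"
  assumes [measurable]: "\<And>n. S n \<in> borel_measurable M"
    and fast: "\<And>n. prob {\<omega> \<in> space M. (1/2) ^ n < \<bar>S (Suc n) \<omega> - S n \<omega>\<bar>} \<le> (1/2) ^ n"
  shows "\<exists>L. tendsto_prob M S L sequentially"
proof -
  have half: "summable (\<lambda>n. (1/2::real) ^ n)" by (rule summable_geometric) simp
  have "AE \<omega> in M. eventually (\<lambda>n. \<omega> \<in> space M - {\<omega> \<in> space M. (1/2) ^ n < \<bar>S (Suc n) \<omega> - S n \<omega>\<bar>}) sequentially"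
  proof (rule borel_cantelli_AE1)
    show "summable (\<lambda>n. prob {\<omega> \<in> space M. (1/2) ^ n < \<bar>S (Suc n) \<omega> - S n \<omega>\<bar>})"
      by (rule summable_comparison_test'[OF half]) (use fast in simp)
  qed (auto simp: less_top[symmetric])
  then have "AE \<omega> in M. (\<lambda>n. S n \<omega>) \<longlonglongrightarrow> lim (\<lambda>n. S n \<omega>)"
  proof eventually_elim
    case (elim \<omega>)
    then have "eventually (\<lambda>n. norm (S (Suc n) \<omega> - S n \<omega>) \<le> (1/2) ^ n) sequentially"
      by eventually_elim auto
    then have "summable (\<lambda>n. S (Suc n) \<omega> - S n \<omega>)"
      using half by (rule summable_comparison_test_ev)
    then have "convergent (\<lambda>n. \<Sum>k<n. S (Suc k) \<omega> - S k \<omega>)"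
      by (simp add: summable_iff_convergent)
    then have "convergent (\<lambda>n. S n \<omega> - S 0 \<omega>)"
      by (simp add: sum_lessThan_telescope[of "\<lambda>n. S n \<omega>"])
    then have "convergent (\<lambda>n. (S n \<omega> - S 0 \<omega>) + S 0 \<omega>)"
      by (rule convergent_add) (rule convergent_const)
    then show ?case by (simp add: convergent_LIMSEQ_iff)
  qed
  then show ?thesis
    \<comment> \<open>The pointwise \<open>lim\<close> is a measurable function on the whole space,
      whatever its values where the sequence diverges.\<close>
    by (intro exI[of _ "\<lambda>\<omega>. lim (\<lambda>n. S n \<omega>)"] AE_LIMSEQ_imp_tendsto_prob) simp_all
qed

text \<open>Convergence over \<open>U\<close> makes finite sums away from some finite set small in
  probability, a property inherited by \<open>B\<close>. A fast Cauchy sequence of finite subsets of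
  \<open>B\<close> then supplies a limit, and the tail bound extends it to the whole filter.\<close>

lemma (in prob_space) tendsto_prob_sum_subset:
  fixes X :: "'w \<Rightarrow> 'a \<Rightarrow> real"
  assumes meas: "\<And>w. w \<in> U \<Longrightarrow> X w \<in> borel_measurable M"
    and lim: "tendsto_prob M (\<lambda>F \<omega>. \<Sum>w\<in>F. X w \<omega>) L (finite_subsets_at_top U)"
    and "B \<subseteq> U"
  shows "\<exists>L'. tendsto_prob M (\<lambda>F \<omega>. \<Sum>w\<in>F. X w \<omega>) L' (finite_subsets_at_top B)"
proof -
  define s where "s F \<omega> = (\<Sum>w\<in>F. X w \<omega>)" for F \<omega>
  have s_meas [measurable]: "s F \<in> borel_measurable M" if "F \<subseteq> U" for F
    unfolding s_def using that meas by (intro borel_measurable_sum) auto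
  have L_meas [measurable]: "L \<in> borel_measurable M"
    using lim by (simp add: tendsto_prob_def)
  have "\<exists>K. finite K \<and> K \<subseteq> U \<and> (\<forall>F. finite F \<and> F \<subseteq> U \<and> F \<inter> K = {} \<longrightarrow>
      prob {\<omega> \<in> space M. (1/2) ^ n < \<bar>s F \<omega>\<bar>} \<le> (1/2) ^ n)" for n :: nat
  proof -
    \<comment> \<open>Half of the target, since a tail sum is the difference of the sums over
      \<open>K \<union> F\<close> and \<open>K\<close>, both close to \<open>L\<close>.\<close>
    let ?e = "(1/2::real) ^ Suc n"
    have "eventually (\<lambda>F. prob {\<omega> \<in> space M. ?e < \<bar>s F \<omega> - L \<omega>\<bar>} < ?e) (finite_subsets_at_top U)"
      by (rule order_tendstoD(2)[OF tendsto_probD[OF lim[folded s_def]]]) simp_all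
    then obtain K where K: "finite K" "K \<subseteq> U"
      and le: "\<And>F. finite F \<Longrightarrow> K \<subseteq> F \<Longrightarrow> F \<subseteq> U \<Longrightarrow> prob {\<omega> \<in> space M. ?e < \<bar>s F \<omega> - L \<omega>\<bar>} < ?e"
      by (auto simp: eventually_finite_subsets_at_top)
    have "prob {\<omega> \<in> space M. (1/2) ^ n < \<bar>s F \<omega>\<bar>} \<le> (1/2) ^ n"
      if F: "finite F" "F \<subseteq> U" "F \<inter> K = {}" for F
    proof -
      have "s (K \<union> F) \<omega> - s K \<omega> = s F \<omega>" for \<omega>
        unfolding s_def using K F by (subst sum.union_disjoint) auto
      then have "prob {\<omega> \<in> space M. (1/2) ^ n < \<bar>s F \<omega>\<bar>}
          = prob {\<omega> \<in> space M. ?e + ?e < \<bar>s (K \<union> F) \<omega> - s K \<omega>\<bar>}" by simp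
      also have "\<dots> \<le> prob {\<omega> \<in> space M. ?e < \<bar>s (K \<union> F) \<omega> - L \<omega>\<bar>}
          + prob {\<omega> \<in> space M. ?e < \<bar>L \<omega> - s K \<omega>\<bar>}"
        using K F by (intro prob_dist_triangle) auto
      also have "\<dots> \<le> ?e + ?e"
        using le[of "K \<union> F"] le[of K] K F by (simp add: abs_minus_commute)
      finally show ?thesis by simp
    qed
    with K show ?thesis by blast
  qed
  then obtain K where K: "\<And>n. finite (K n)" "\<And>n. K n \<subseteq> U"
    and tail: "\<And>n F. finite F \<Longrightarrow> F \<subseteq> U \<Longrightarrow> F \<inter> K n = {} \<Longrightarrow>
      prob {\<omega> \<in> space M. (1/2) ^ n < \<bar>s F \<omega>\<bar>} \<le> (1/2) ^ n"
    by metis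
  \<comment> \<open>The union makes \<open>G\<close> increasing. Moreover, what a subset of
    \<open>B\<close> containing \<open>G n\<close> has beyond \<open>G n\<close> avoids
    \<open>K n\<close>, so the tail bound applies to it.\<close>
  define G where "G n = (\<Union>i\<le>n. K i) \<inter> B" for n
  have G: "finite (G n)" "G n \<subseteq> B" "G n \<subseteq> U" for n
    using K \<open>B \<subseteq> U\<close> by (auto simp: G_def)
  have near: "prob {\<omega> \<in> space M. (1/2) ^ n < \<bar>s F \<omega> - s (G n) \<omega>\<bar>} \<le> (1/2) ^ n"
    if "finite F" "G n \<subseteq> F" "F \<subseteq> B" for F n
  proof -
    have "s F \<omega> - s (G n) \<omega> = s (F - G n) \<omega>" for \<omega>
      unfolding s_def using that by (simp add: sum_diff)
    moreover have "(F - G n) \<inter> K n = {}" "F - G n \<subseteq> U" using that \<open>B \<subseteq> U\<close> by (auto simp: G_def)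
    ultimately show ?thesis
      using tail[of "F - G n" n] that by simp
  qed
  have "\<exists>L'. tendsto_prob M (\<lambda>n. s (G n)) L' sequentially"
  proof (rule tendsto_prob_fast_Cauchy)
    show "prob {\<omega> \<in> space M. (1/2) ^ n < \<bar>s (G (Suc n)) \<omega> - s (G n) \<omega>\<bar>} \<le> (1/2) ^ n" for n
      using G by (intro near) (auto simp: G_def intro: le_SucI)
  qed (use G in simp)
  then obtain L' where L': "tendsto_prob M (\<lambda>n. s (G n)) L' sequentially" ..
  then have [measurable]: "L' \<in> borel_measurable M" by (simp add: tendsto_prob_def)
  have "tendsto_prob M s L' (finite_subsets_at_top B)"
    unfolding tendsto_prob_def
  proof (intro conjI allI impI)
    fix \<epsilon> :: real assume "0 < \<epsilon>"
    show "((\<lambda>F. prob {\<omega> \<in> space M. \<epsilon> < \<bar>s F \<omega> - L' \<omega>\<bar>}) \<longlongrightarrow> 0) (finite_subsets_at_top B)"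
    proof (rule order_tendstoI)
      fix \<delta> :: real assume "0 < \<delta>"
      \<comment> \<open>The power bounds both the deviation and its probability, hence one
        \<open>n\<close> below half of \<epsilon> and half of \<delta>.\<close>
      have "(\<lambda>n. (1/2::real) ^ n) \<longlonglongrightarrow> 0" by (rule LIMSEQ_power_zero) simp
      then have "eventually (\<lambda>n. (1/2::real) ^ n < min (\<epsilon>/2) (\<delta>/2)) sequentially"
        using \<open>0 < \<epsilon>\<close> \<open>0 < \<delta>\<close> by (intro order_tendstoD(2)) auto
      moreover have "eventually (\<lambda>n. prob {\<omega> \<in> space M. \<epsilon>/2 < \<bar>s (G n) \<omega> - L' \<omega>\<bar>} < \<delta>/2) sequentially"
        using \<open>0 < \<epsilon>\<close> \<open>0 < \<delta>\<close> by (intro order_tendstoD(2)[OF tendsto_probD[OF L']]) simp_all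
      ultimately have "eventually (\<lambda>n. (1/2::real) ^ n < min (\<epsilon>/2) (\<delta>/2) \<and>
          prob {\<omega> \<in> space M. \<epsilon>/2 < \<bar>s (G n) \<omega> - L' \<omega>\<bar>} < \<delta>/2) sequentially"
        by (rule eventually_conj)
      then obtain n where n: "(1/2::real) ^ n < \<epsilon>/2" "(1/2::real) ^ n < \<delta>/2"
          "prob {\<omega> \<in> space M. \<epsilon>/2 < \<bar>s (G n) \<omega> - L' \<omega>\<bar>} < \<delta>/2"
        by (auto simp: eventually_sequentially)
      have "prob {\<omega> \<in> space M. \<epsilon> < \<bar>s F \<omega> - L' \<omega>\<bar>} < \<delta>"
        if F: "finite F" "G n \<subseteq> F" "F \<subseteq> B" for F
      proof -
        have [measurable]: "s F \<in> borel_measurable M" "s (G n) \<in> borel_measurable M"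
          using F G \<open>B \<subseteq> U\<close> by auto
        have "prob {\<omega> \<in> space M. \<epsilon>/2 < \<bar>s F \<omega> - s (G n) \<omega>\<bar>}
          \<le> prob {\<omega> \<in> space M. (1/2) ^ n < \<bar>s F \<omega> - s (G n) \<omega>\<bar>}"
          using n(1) by (intro finite_measure_mono) auto
        also have "\<dots> < \<delta>/2" using near[OF F] n(2) by simp
        finally show ?thesis
          using prob_dist_triangle[of "s F" "s (G n)" L' "\<epsilon>/2" "\<epsilon>/2"] n(3) by simp
      qed
      then show "eventually (\<lambda>F. prob {\<omega> \<in> space M. \<epsilon> < \<bar>s F \<omega> - L' \<omega>\<bar>} < \<delta>) (finite_subsets_at_top B)"
        unfolding eventually_finite_subsets_at_top using G[of n] by blast
    qed (auto intro: less_le_trans[OF _ measure_nonneg])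
  qed fact
  then show ?thesis unfolding s_def by blast
qed

text \<open>From left to right the limit over \<open>B\<close> comes from
  \<open>tendsto_prob_sum_subset\<close>, and the limit over \<open>C\<close> is the difference. The
  converse is additivity along the filter of \<open>U\<close>.\<close>

lemma (in prob_space) tendsto_prob_sum_partition:
  fixes X :: "'w \<Rightarrow> 'a \<Rightarrow> real"
  assumes meas: "\<And>w. w \<in> B \<union> C \<Longrightarrow> X w \<in> borel_measurable M"
    and zero: "\<And>w \<omega>. w \<in> U - (B \<union> C) \<Longrightarrow> X w \<omega> = 0"
    and sub: "B \<subseteq> U" "C \<subseteq> U" "B \<inter> C = {}"
  shows "tendsto_prob M (\<lambda>F \<omega>. \<Sum>w\<in>F. X w \<omega>) L (finite_subsets_at_top U) \<longleftrightarrow>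
    (\<exists>L\<^sub>1 L\<^sub>2. tendsto_prob M (\<lambda>F \<omega>. \<Sum>w\<in>F. X w \<omega>) L\<^sub>1 (finite_subsets_at_top B) \<and>
       tendsto_prob M (\<lambda>F \<omega>. \<Sum>w\<in>F. X w \<omega>) L\<^sub>2 (finite_subsets_at_top C) \<and>
       (\<forall>\<omega>\<in>space M. L \<omega> = L\<^sub>1 \<omega> + L\<^sub>2 \<omega>))"
    (is "?lhs \<longleftrightarrow> ?rhs")
proof -
  let ?s = "\<lambda>F \<omega>. \<Sum>w\<in>F. X w \<omega>"
  have X_meas: "X w \<in> borel_measurable M" if "w \<in> U" for w
  proof (cases "w \<in> B \<union> C")
    case False
    with zero that have "X w = (\<lambda>_. 0)" by (auto simp: fun_eq_iff)
    then show ?thesis by simp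
  qed (rule meas)
  have s_meas: "?s F \<in> borel_measurable M" if "F \<subseteq> U" for F
    using that X_meas by (intro borel_measurable_sum) auto
  have s_meas_Int: "eventually (\<lambda>F. ?s (F \<inter> E) \<in> borel_measurable M) (finite_subsets_at_top U)" for E
    by (rule eventually_finite_subsets_at_top_weakI) (auto intro!: s_meas)
  have restrict: "tendsto_prob M ?s K (finite_subsets_at_top E) \<longleftrightarrow>
      tendsto_prob M (\<lambda>F. ?s (F \<inter> E)) K (finite_subsets_at_top U)" if "E \<subseteq> U" for E K
    by (simp add: tendsto_prob_filtermap flip: filtermap_Int_finite_subsets_at_top[OF that])
  have split: "?s F \<omega> = ?s (F \<inter> B) \<omega> + ?s (F \<inter> C) \<omega>" if "finite F" "F \<subseteq> U" for F \<omega>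
  proof -
    have "?s (F \<inter> B) \<omega> + ?s (F \<inter> C) \<omega> = ?s (F \<inter> B \<union> F \<inter> C) \<omega>"
      using that sub by (subst sum.union_disjoint) auto
    also have "\<dots> = ?s F \<omega>"
      using that zero by (intro sum.mono_neutral_left) auto
    finally show ?thesis by simp
  qed
  show ?thesis
  proof
    assume ?lhs
    with tendsto_prob_sum_subset[of U X, OF X_meas _ sub(1)] obtain L\<^sub>1
      where L\<^sub>1: "tendsto_prob M ?s L\<^sub>1 (finite_subsets_at_top B)" by blast
    then have "tendsto_prob M (\<lambda>F \<omega>. ?s F \<omega> + - ?s (F \<inter> B) \<omega>) (\<lambda>\<omega>. L \<omega> + - L\<^sub>1 \<omega>) (finite_subsets_at_top U)"
      using \<open>?lhs\<close> s_meas_Int[of B]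
      by (intro tendsto_prob_add tendsto_prob_minus)
         (auto simp: restrict[OF sub(1)] intro: s_meas elim: eventually_mono)
    also have "?this \<longleftrightarrow> tendsto_prob M (\<lambda>F. ?s (F \<inter> C)) (\<lambda>\<omega>. L \<omega> - L\<^sub>1 \<omega>) (finite_subsets_at_top U)"
      by (rule tendsto_prob_cong) (auto simp: split)
    finally have "tendsto_prob M ?s (\<lambda>\<omega>. L \<omega> - L\<^sub>1 \<omega>) (finite_subsets_at_top C)"
      by (simp add: restrict[OF sub(2)])
    with L\<^sub>1 show ?rhs by (intro exI[of _ L\<^sub>1] exI[of _ "\<lambda>\<omega>. L \<omega> - L\<^sub>1 \<omega>"]) simp
  next
    assume ?rhs
    then obtain L\<^sub>1 L\<^sub>2 where "tendsto_prob M ?s L\<^sub>1 (finite_subsets_at_top B)"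
      "tendsto_prob M ?s L\<^sub>2 (finite_subsets_at_top C)" and L: "\<And>\<omega>. \<omega> \<in> space M \<Longrightarrow> L \<omega> = L\<^sub>1 \<omega> + L\<^sub>2 \<omega>"
      by blast
    then have "tendsto_prob M (\<lambda>F \<omega>. ?s (F \<inter> B) \<omega> + ?s (F \<inter> C) \<omega>) (\<lambda>\<omega>. L\<^sub>1 \<omega> + L\<^sub>2 \<omega>) (finite_subsets_at_top U)"
      using s_meas_Int by (intro tendsto_prob_add) (simp_all add: restrict[OF sub(1)] restrict[OF sub(2)])
    also have "?this \<longleftrightarrow> ?lhs"
      by (rule tendsto_prob_cong) (auto simp: split L)
    finally show ?lhs .
  qed
qed

lemma series_sum_cong:
  assumes "\<And>w. w \<in> P \<Longrightarrow> c w = c' w"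
  shows "series_sum M D Vt P c = series_sum M D Vt P c'"
proof (rule ext)
  fix \<Phi>
  have "tendsto_prob M (\<lambda>F \<omega>. \<Sum>w\<in>F. c w \<omega> * word_op Vt w f y) (\<Phi> f y) (finite_subsets_at_top P) \<longleftrightarrow>
      tendsto_prob M (\<lambda>F \<omega>. \<Sum>w\<in>F. c' w \<omega> * word_op Vt w f y) (\<Phi> f y) (finite_subsets_at_top P)" for f y
    by (rule tendsto_prob_cong)
       (auto intro!: eventually_finite_subsets_at_top_weakI sum.cong simp: assms subset_iff)
  then show "series_sum M D Vt P c \<Phi> = series_sum M D Vt P c' \<Phi>"
    by (simp add: series_sum_def)
qed

text \<open>The scalar statement is applied for each test function and initial value.\<close>

lemma (in prob_space) series_sum_partition:
  assumes meas: "\<And>w. w \<in> B \<union> C \<Longrightarrow> c w \<in> borel_measurable M"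
    and zero: "\<And>w \<omega>. w \<in> U - (B \<union> C) \<Longrightarrow> c w \<omega> = 0"
    and sub: "B \<subseteq> U" "C \<subseteq> U" "B \<inter> C = {}"
  shows "series_sum M D Vt U c \<Phi> \<longleftrightarrow>
    (\<exists>\<Phi>\<^sub>1 \<Phi>\<^sub>2. series_sum M D Vt B c \<Phi>\<^sub>1 \<and> series_sum M D Vt C c \<Phi>\<^sub>2 \<and>
       (\<forall>f\<in>D. \<forall>y. \<forall>\<omega>\<in>space M. \<Phi> f y \<omega> = \<Phi>\<^sub>1 f y \<omega> + \<Phi>\<^sub>2 f y \<omega>))"
proof -
  define R where "R f y L\<^sub>1 L\<^sub>2 \<longleftrightarrow>
      tendsto_prob M (\<lambda>F \<omega>. \<Sum>w\<in>F. c w \<omega> * word_op Vt w f y) L\<^sub>1 (finite_subsets_at_top B) \<and>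
      tendsto_prob M (\<lambda>F \<omega>. \<Sum>w\<in>F. c w \<omega> * word_op Vt w f y) L\<^sub>2 (finite_subsets_at_top C) \<and>
      (\<forall>\<omega>\<in>space M. \<Phi> f y \<omega> = L\<^sub>1 \<omega> + L\<^sub>2 \<omega>)" for f y L\<^sub>1 L\<^sub>2
  have "tendsto_prob M (\<lambda>F \<omega>. \<Sum>w\<in>F. c w \<omega> * word_op Vt w f y) (\<Phi> f y) (finite_subsets_at_top U)
      \<longleftrightarrow> (\<exists>L\<^sub>1 L\<^sub>2. R f y L\<^sub>1 L\<^sub>2)" for f y
    unfolding R_def using meas zero sub by (intro tendsto_prob_sum_partition) auto
  then have "series_sum M D Vt U c \<Phi> \<longleftrightarrow> (\<forall>f\<in>D. \<forall>y. \<exists>L\<^sub>1 L\<^sub>2. R f y L\<^sub>1 L\<^sub>2)"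
    by (simp add: series_sum_def)
  \<comment> \<open>The choice axiom collects the limits for the individual \<open>f\<close> and
    \<open>y\<close> into two random operators.\<close>
  also have "\<dots> \<longleftrightarrow> (\<exists>\<Phi>\<^sub>1 \<Phi>\<^sub>2. \<forall>f\<in>D. \<forall>y. R f y (\<Phi>\<^sub>1 f y) (\<Phi>\<^sub>2 f y))"
    by metis
  finally show ?thesis
    unfolding R_def series_sum_def by blast
qed

section \<open>The two forms of the integrator\<close>

theorem lemma3:
  fixes M :: "'o measure"
    and d l n :: nat
    and \<rho> :: "nat \<Rightarrow> real measure"
    and Q :: "nat \<Rightarrow> 'o \<Rightarrow> (real \<times> real) measure"
    and Z :: "letter \<Rightarrow> 'o process"
    and br :: "letter \<Rightarrow> letter \<Rightarrow> (letter \<Rightarrow>\<^sub>0 real)"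
    and I :: "letter list \<Rightarrow> 'o process"
    and V :: "nat \<Rightarrow> real ^ 'n \<Rightarrow> real ^ 'n"
    and Y :: "real \<Rightarrow> real ^ 'n \<Rightarrow> 'o \<Rightarrow> real ^ 'n"
    and D :: "(real ^ 'n \<Rightarrow> real) set"
    and Vt :: "letter \<Rightarrow> (real ^ 'n \<Rightarrow> real) \<Rightarrow> real ^ 'n \<Rightarrow> real"
    and t :: real
    and A :: "letter set"
    and integrator :: "letter list \<Rightarrow> 'o \<Rightarrow> real"
    and cosh\<^sub>1 cosh\<^sub>2 :: "letter list \<Rightarrow> 'o \<Rightarrow> real"
  assumes setting: "levy_flow M d l \<rho> Q Z br I V Y D Vt"
    and t: "0 \<le> t"
  defines "A \<equiv> alphabet M d l Z"
    and "integrator \<equiv> (\<lambda>w. word_integral I (antisym_sign_rev_map n (word w)) t)"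
    and "cosh\<^sub>1 \<equiv> (\<lambda>w. word_integral I (coshlog shuffle (word w)) t)"
    and "cosh\<^sub>2 \<equiv> (\<lambda>w \<omega>. word_integral I (coshlog (qshuffle br) (word w)) t \<omega>
            + 1/2 * word_integral I (sign_rev (word w) - qs_antipode br (word w)) t \<omega>)"
  shows "\<forall>c \<in> {cosh\<^sub>1, cosh\<^sub>2}.
      formal_series Vt (lists A) integrator
        = (\<lambda>w \<omega> f y. formal_series Vt {w \<in> lists A. length w \<le> n} (\<lambda>w. I w t) w \<omega> f y
                   + formal_series Vt {w \<in> lists A. length w = n + 1} c w \<omega> f y)
    \<and> (\<forall>\<Phi>. series_sum M D Vt (lists A) integrator \<Phi> \<longleftrightarrow>
         (\<exists>\<Phi>\<^sub>1 \<Phi>\<^sub>2. series_sum M D Vt {w \<in> lists A. length w \<le> n} (\<lambda>w. I w t) \<Phi>\<^sub>1 \<and>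
            series_sum M D Vt {w \<in> lists A. length w = n + 1} c \<Phi>\<^sub>2 \<and>
            (\<forall>f\<in>D. \<forall>y. \<forall>\<omega>\<in>space M. \<Phi> f y \<omega> = \<Phi>\<^sub>1 f y \<omega> + \<Phi>\<^sub>2 f y \<omega>)))"
proof
  fix c assume c: "c \<in> {cosh\<^sub>1, cosh\<^sub>2}"
  interpret levy_flow M d l \<rho> Q Z br I V Y D Vt by (rule setting)
  interpret bracket_algebra A br
    by unfold_locales (fact bracket_closed[folded A_def] bracket_commute[folded A_def] bracket_assoc[folded A_def])+
  have short: "integrator w = I w t" if "length w \<le> n" for w
    using that by (simp add: integrator_def antisym_sign_rev_map_word word_integral_def fun_eq_iff)
  \<comment> \<open>The explicit coefficient yields measurability on level \<open>n + 1\<close>,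
    since the reversal of a word over \<open>A\<close> is again one.\<close>
  have next_level: "integrator w = (\<lambda>\<omega>. (I w t \<omega> + (-1) ^ length w * I (rev w) t \<omega>) / 2)" if "length w = n + 1" for w
    using that by (simp add: integrator_def antisym_sign_rev_map_word word_integral_def sign_rev_def fun_eq_iff)
  have long: "integrator w \<omega> = 0" if "n + 1 < length w" for w \<omega>
    using that by (simp add: integrator_def antisym_sign_rev_map_word word_integral_def)
  have "cosh\<^sub>1 w = integrator w" if "length w = n + 1" for w
    using that coshlog_shuffle_word[of w]
    by (cases w) (simp_all add: cosh\<^sub>1_def integrator_def antisym_sign_rev_map_word)
  moreover have "cosh\<^sub>2 w = integrator w" if "w \<in> lists A" "length w = n + 1" for w
  proof -
    \<comment> \<open>The correction by half of \<open>sign_rev - qs_antipode br\<close> exchanges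
      the antipode for the sign reversal. The bracket axioms are used here, hence the restriction to
      words over \<open>A\<close>.\<close>
    have "coshlog (qshuffle br) (word w) = (1/2) *\<^sub>R (word w + qs_antipode br (word w))"
      using that by (intro coshlog_qshuffle_word) auto
    with that show ?thesis
      by (simp add: cosh\<^sub>2_def integrator_def antisym_sign_rev_map_word word_integral_def fun_eq_iff
          add_divide_distrib diff_divide_distrib)
  qed
  ultimately have c_eq: "c w = integrator w" if "w \<in> lists A" "length w = n + 1" for w
    using that c by auto
  let ?B = "{w \<in> lists A. length w \<le> n}" and ?C = "{w \<in> lists A. length w = n + 1}"
  have I_meas: "I w t \<in> borel_measurable M" if "w \<in> lists A" for w
    using integral_cadlag[folded A_def, OF that] t by (simp add: cadlag_process_def)
  have meas: "integrator w \<in> borel_measurable M" if "w \<in> ?B \<union> ?C" for w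
  proof -
    from that have "w \<in> lists A" "rev w \<in> lists A" by auto
    then have [measurable]: "I w t \<in> borel_measurable M" "I (rev w) t \<in> borel_measurable M"
      by (auto intro: I_meas)
    show ?thesis
    proof (cases "length w \<le> n")
      case False
      with that have "length w = n + 1" by auto
      then show ?thesis unfolding next_level[OF \<open>length w = n + 1\<close>] by measurable
    qed (simp add: short)
  qed
  have "formal_series Vt (lists A) integrator w \<omega> f y
      = formal_series Vt ?B (\<lambda>w. I w t) w \<omega> f y + formal_series Vt ?C c w \<omega> f y" for w \<omega> f y
    using short[of w] c_eq[of w] long[of w \<omega>]
    by (cases "length w \<le> n"; cases "length w = n + 1") (simp_all add: formal_series_def)
  moreover have "series_sum M D Vt (lists A) integrator \<Phi> \<longleftrightarrow>
      (\<exists>\<Phi>\<^sub>1 \<Phi>\<^sub>2. series_sum M D Vt ?B (\<lambda>w. I w t) \<Phi>\<^sub>1 \<and> series_sum M D Vt ?C c \<Phi>\<^sub>2 \<and>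
         (\<forall>f\<in>D. \<forall>y. \<forall>\<omega>\<in>space M. \<Phi> f y \<omega> = \<Phi>\<^sub>1 f y \<omega> + \<Phi>\<^sub>2 f y \<omega>))" for \<Phi>
  proof -
    \<comment> \<open>A sum over a set of words sees its coefficients only on that set, so both
      parts can be rewritten with those of the integrator.\<close>
    have "series_sum M D Vt ?B (\<lambda>w. I w t) = series_sum M D Vt ?B integrator"
      "series_sum M D Vt ?C c = series_sum M D Vt ?C integrator"
      by (rule series_sum_cong; simp add: short c_eq)+
    moreover have "series_sum M D Vt (lists A) integrator \<Phi> \<longleftrightarrow>
        (\<exists>\<Phi>\<^sub>1 \<Phi>\<^sub>2. series_sum M D Vt ?B integrator \<Phi>\<^sub>1 \<and> series_sum M D Vt ?C integrator \<Phi>\<^sub>2 \<and>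
         (\<forall>f\<in>D. \<forall>y. \<forall>\<omega>\<in>space M. \<Phi> f y \<omega> = \<Phi>\<^sub>1 f y \<omega> + \<Phi>\<^sub>2 f y \<omega>))"
      by (rule series_sum_partition[OF meas]) (auto intro!: long)
    ultimately show ?thesis by simp
  qed
  ultimately show "formal_series Vt (lists A) integrator
        = (\<lambda>w \<omega> f y. formal_series Vt ?B (\<lambda>w. I w t) w \<omega> f y + formal_series Vt ?C c w \<omega> f y)
    \<and> (\<forall>\<Phi>. series_sum M D Vt (lists A) integrator \<Phi> \<longleftrightarrow>
         (\<exists>\<Phi>\<^sub>1 \<Phi>\<^sub>2. series_sum M D Vt ?B (\<lambda>w. I w t) \<Phi>\<^sub>1 \<and> series_sum M D Vt ?C c \<Phi>\<^sub>2 \<and>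
            (\<forall>f\<in>D. \<forall>y. \<forall>\<omega>\<in>space M. \<Phi> f y \<omega> = \<Phi>\<^sub>1 f y \<omega> + \<Phi>\<^sub>2 f y \<omega>)))"
    by (auto simp: fun_eq_iff)
qed

end
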